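(* Let $\epsilon>0$ be a constant. If the Boxes Class Cover problem (BCC) can be approximated in polynomial time within a constant factor of $1+\epsilon$, then, for every nonnegative integer constant $d$, the (minimum) Vertex Cover problem restricted to simple undirected graphs of maximum degree at most $d$ can be approximated in polynomial time within a constant factor of $1+(d+1)\epsilon$.
   Context: All boxes are closed, bounded, axis-aligned rectangles in the plane with non-empty interior. A box covers a point $p$ if $p$ lies in the interior of the box. Boxes Class Cover (BCC): given a finite set $S=R\cup B$ of $n$ points in the plane, with $R\cap B=\emptyset$, where the points of $R$ are called red and those of $B$ blue, find a smallest-cardinality set of axis-aligned boxes such that every red point is covered by some box of the set and no box of the set covers a blue point. A minimization problem can be approximated in polynomial time within a factor $\rho\ge 1$ if there is a polynomial-time algorithm that, on every instance, outputs a feasible solution whose size is at most $\rho$ times the minimum size of a feasible solution. *)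

theory Defs
  imports "HOL-Analysis.Analysis" "HOL-Library.Log_Nat" "HOL-Computational_Algebra.Polynomial"
begin

section \<open>Polynomial-time computation\<close>

text \<open>
  Algorithms are deterministic while-programs whose variables hold finite binary trees with
  integer leaves (S-expressions).  The cost measure is logarithmic: every evaluation of a
  subexpression is charged the bit size of the tree it yields, and every command is charged at
  least one unit.  A run of cost \<open>t\<close> therefore never holds more than the input size plus
  \<open>O(t)\<close> bits, and each of its steps is a polynomial-time operation on the charged data, so
  that polynomial cost here is polynomial time on a Turing machine, and conversely.
\<close>

datatype val = Num int | Cell val val

fun val_size :: "val \<Rightarrow> nat" where
  "val_size (Num k) = 1 + floorlog 2 (nat \<bar>k\<bar>)"
| "val_size (Cell a b) = 1 + val_size a + val_size b"

text \<open>The accessors are total; on arguments of the wrong shape they return default values.\<close>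

fun val_fst :: "val \<Rightarrow> val" where
  "val_fst (Cell a b) = a"
| "val_fst (Num k) = Num 0"

fun val_snd :: "val \<Rightarrow> val" where
  "val_snd (Cell a b) = b"
| "val_snd (Num k) = Num 0"

fun val_int :: "val \<Rightarrow> int" where
  "val_int (Num k) = k"
| "val_int (Cell a b) = 0"

definition val_bool :: "bool \<Rightarrow> val" where
  "val_bool P = Num (if P then 1 else 0)"

datatype expr =
    Var nat | Const int
  | MkCell expr expr | Fst expr | Snd expr
  | Plus expr expr | Minus expr expr | Times expr expr
  | Less expr expr | Equal expr expr

type_synonym state = "nat \<Rightarrow> val"

fun eval :: "expr \<Rightarrow> state \<Rightarrow> val" where
  "eval (Var x) s = s x"
| "eval (Const k) s = Num k"
| "eval (MkCell e f) s = Cell (eval e s) (eval f s)"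
| "eval (Fst e) s = val_fst (eval e s)"
| "eval (Snd e) s = val_snd (eval e s)"
| "eval (Plus e f) s = Num (val_int (eval e s) + val_int (eval f s))"
| "eval (Minus e f) s = Num (val_int (eval e s) - val_int (eval f s))"
| "eval (Times e f) s = Num (val_int (eval e s) * val_int (eval f s))"
| "eval (Less e f) s = val_bool (val_int (eval e s) < val_int (eval f s))"
| "eval (Equal e f) s = val_bool (eval e s = eval f s)"

fun subcost :: "expr \<Rightarrow> state \<Rightarrow> nat" and ecost :: "expr \<Rightarrow> state \<Rightarrow> nat" where
  "subcost (Var x) s = 0"
| "subcost (Const k) s = 0"
| "subcost (MkCell e f) s = ecost e s + ecost f s"
| "subcost (Fst e) s = ecost e s"
| "subcost (Snd e) s = ecost e s"
| "subcost (Plus e f) s = ecost e s + ecost f s"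
| "subcost (Minus e f) s = ecost e s + ecost f s"
| "subcost (Times e f) s = ecost e s + ecost f s"
| "subcost (Less e f) s = ecost e s + ecost f s"
| "subcost (Equal e f) s = ecost e s + ecost f s"
| "ecost e s = val_size (eval e s) + subcost e s"

datatype com =
    Skip | Assign nat expr | Seq com com | Cond expr com com | While expr com

text \<open>
  \<open>exec c s t s'\<close>: started in \<open>s\<close>, the program \<open>c\<close> terminates in \<open>s'\<close> at cost \<open>t\<close>.
  Every tree except \<open>Num 0\<close> counts as true.
\<close>

inductive exec :: "com \<Rightarrow> state \<Rightarrow> nat \<Rightarrow> state \<Rightarrow> bool" where
  Skip: "exec Skip s 1 s"
| Assign: "exec (Assign x e) s (1 + ecost e s) (s(x := eval e s))"
| Seq: "exec c s t s' \<Longrightarrow> exec c' s' t' s'' \<Longrightarrow> exec (Seq c c') s (1 + t + t') s''"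
| CondTrue: "eval e s \<noteq> Num 0 \<Longrightarrow> exec c s t s' \<Longrightarrow> exec (Cond e c c') s (1 + ecost e s + t) s'"
| CondFalse: "eval e s = Num 0 \<Longrightarrow> exec c' s t s' \<Longrightarrow> exec (Cond e c c') s (1 + ecost e s + t) s'"
| WhileFalse: "eval e s = Num 0 \<Longrightarrow> exec (While e c) s (1 + ecost e s) s"
| WhileTrue: "eval e s \<noteq> Num 0 \<Longrightarrow> exec c s t s' \<Longrightarrow> exec (While e c) s' t' s'' \<Longrightarrow>
    exec (While e c) s (1 + ecost e s + t + t') s''"

lemma exec_deterministic:
  "exec c s t s' \<Longrightarrow> exec c s u s'' \<Longrightarrow> u = t \<and> s'' = s'"
proof (induction arbitrary: u s'' rule: exec.induct)
  case (Skip s)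
  then show ?case by (auto elim: exec.cases)
next
  case (Assign x e s)
  then show ?case by (auto elim: exec.cases)
next
  case (Seq c s t s' c' t' s3)
  from Seq.prems show ?case by (cases rule: exec.cases) (use Seq.IH in blast)
next
  case (CondTrue e s c t s' c')
  from CondTrue.prems show ?case by (cases rule: exec.cases) (use CondTrue in blast)+
next
  case (CondFalse e s c' t s' c)
  from CondFalse.prems show ?case by (cases rule: exec.cases) (use CondFalse in blast)+
next
  case (WhileFalse e s c)
  from WhileFalse.prems show ?case by (cases rule: exec.cases) (use WhileFalse in blast)+
next
  case (WhileTrue e s c t s' t' s3)
  from WhileTrue.prems show ?case by (cases rule: exec.cases) (use WhileTrue in blast)+
qed

text \<open>Variable 0 holds the input at the start and the output at the end.\<close>

definition init_state :: "val \<Rightarrow> state" where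
  "init_state v = (\<lambda>_. Num 0)(0 := v)"

section \<open>Approximation of minimization problems\<close>

text \<open>
  The last two components say which trees are encodings of an instance or of a solution.
\<close>

record ('i, 's) min_problem =
  instances :: "'i set"
  feasible :: "'i \<Rightarrow> 's \<Rightarrow> bool"
  sol_size :: "'s \<Rightarrow> nat"
  codes_instance :: "'i \<Rightarrow> val \<Rightarrow> bool"
  codes_solution :: "'s \<Rightarrow> val \<Rightarrow> bool"

definition opt :: "('i, 's) min_problem \<Rightarrow> 'i \<Rightarrow> nat" where
  "opt P I = (LEAST k. \<exists>S. feasible P I S \<and> sol_size P S = k)"

definition poly_time_approximable :: "('i, 's) min_problem \<Rightarrow> real \<Rightarrow> bool" where
  "poly_time_approximable P \<rho> \<longleftrightarrow>
    (\<exists>c :: com. \<exists>p :: nat poly. \<forall>I \<in> instances P. \<forall>v. codes_instance P I v \<longrightarrow>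
      (\<exists>t s S. exec c (init_state v) t s \<and> t \<le> poly p (val_size v) \<and>
        codes_solution P S (s 0) \<and> feasible P I S \<and>
        real (sol_size P S) \<le> \<rho> * real (opt P I)))"

section \<open>Encodings\<close>

definition val_list :: "val list \<Rightarrow> val" where
  "val_list vs = foldr Cell vs (Num 0)"

text \<open>A finite set is encoded by listing its elements, in any order and without repetition.\<close>

definition codes_set :: "('a \<Rightarrow> val \<Rightarrow> bool) \<Rightarrow> 'a set \<Rightarrow> val \<Rightarrow> bool" where
  "codes_set C A v \<longleftrightarrow>
    (\<exists>xs vs. distinct xs \<and> set xs = A \<and> list_all2 C xs vs \<and> v = val_list vs)"

text \<open>Only rational numbers have an encoding, namely as a fraction in lowest terms.\<close>

definition codes_real :: "real \<Rightarrow> val \<Rightarrow> bool" where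
  "codes_real x v \<longleftrightarrow>
    (\<exists>a b :: int. b > 0 \<and> coprime a b \<and> x = of_int a / of_int b \<and> v = Cell (Num a) (Num b))"

definition codes_point :: "real \<times> real \<Rightarrow> val \<Rightarrow> bool" where
  "codes_point p v \<longleftrightarrow>
    (\<exists>a b. codes_real (fst p) a \<and> codes_real (snd p) b \<and> v = Cell a b)"

text \<open>A box is encoded by its lower left and upper right corners.\<close>

definition codes_box :: "(real \<times> real) set \<Rightarrow> val \<Rightarrow> bool" where
  "codes_box X v \<longleftrightarrow>
    (\<exists>p q a b. X = cbox p q \<and> codes_point p a \<and> codes_point q b \<and> v = Cell a b)"

definition codes_vertex :: "nat \<Rightarrow> val \<Rightarrow> bool" where
  "codes_vertex u v \<longleftrightarrow> v = Num (int u)"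

text \<open>An edge is encoded by its two endpoints, in either order.\<close>

definition codes_edge :: "nat set \<Rightarrow> val \<Rightarrow> bool" where
  "codes_edge e v \<longleftrightarrow> (\<exists>u w. e = {u, w} \<and> v = Cell (Num (int u)) (Num (int w)))"

definition codes_pair ::
  "('a \<Rightarrow> val \<Rightarrow> bool) \<Rightarrow> ('b \<Rightarrow> val \<Rightarrow> bool) \<Rightarrow> 'a \<times> 'b \<Rightarrow> val \<Rightarrow> bool" where
  "codes_pair C D x v \<longleftrightarrow> (\<exists>a b. C (fst x) a \<and> D (snd x) b \<and> v = Cell a b)"

section \<open>Boxes Class Cover\<close>

definition is_box :: "(real \<times> real) set \<Rightarrow> bool" where
  "is_box X \<longleftrightarrow> (\<exists>p q. X = cbox p q) \<and> interior X \<noteq> {}"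

definition covers :: "(real \<times> real) set \<Rightarrow> real \<times> real \<Rightarrow> bool" where
  "covers X p \<longleftrightarrow> p \<in> interior X"

definition class_cover ::
  "(real \<times> real) set \<times> (real \<times> real) set \<Rightarrow> (real \<times> real) set set \<Rightarrow> bool" where
  "class_cover = (\<lambda>(R, B) T. finite T \<and> (\<forall>X\<in>T. is_box X) \<and>
    (\<forall>r\<in>R. \<exists>X\<in>T. covers X r) \<and> (\<forall>X\<in>T. \<forall>b\<in>B. \<not> covers X b))"

definition BCC ::
  "((real \<times> real) set \<times> (real \<times> real) set, (real \<times> real) set set) min_problem" where
  "BCC = \<lparr> instances = {(R, B). finite R \<and> finite B \<and> R \<inter> B = {}},
    feasible = class_cover,
    sol_size = card,
    codes_instance = codes_pair (codes_set codes_point) (codes_set codes_point),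
    codes_solution = codes_set codes_box \<rparr>"

section \<open>Vertex Cover in graphs of bounded degree\<close>

text \<open>A graph is a pair of a vertex set and a set of edges, which are two-element vertex sets.\<close>

definition simple_graph :: "nat set \<times> nat set set \<Rightarrow> bool" where
  "simple_graph = (\<lambda>(V, E). finite V \<and> (\<forall>e\<in>E. e \<subseteq> V \<and> card e = 2))"

definition degree_in :: "nat set set \<Rightarrow> nat \<Rightarrow> nat" where
  "degree_in E v = card {e \<in> E. v \<in> e}"

definition vertex_cover :: "nat set \<times> nat set set \<Rightarrow> nat set \<Rightarrow> bool" where
  "vertex_cover = (\<lambda>(V, E) C. C \<subseteq> V \<and> (\<forall>e\<in>E. e \<inter> C \<noteq> {}))"

definition Vertex_Cover :: "nat \<Rightarrow> (nat set \<times> nat set set, nat set) min_problem" where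
  "Vertex_Cover d = \<lparr> instances = {(V, E). simple_graph (V, E) \<and> (\<forall>v\<in>V. degree_in E v \<le> d)},
    feasible = vertex_cover,
    sol_size = card,
    codes_instance = codes_pair (codes_set codes_vertex) (codes_set codes_edge),
    codes_solution = codes_set codes_vertex \<rparr>"

end

theory Submission imports Defs
begin

text \<open>
  An edge \<open>e\<close> between \<open>u\<close> and \<open>w\<close> becomes three red points: a port in row \<open>4 u\<close>, a port in row
  \<open>4 w\<close>, and between their columns a centre in row \<open>4 u + 2\<close>.  Blue points placed next to these
  leave only two kinds of boxes that cover several red points: boxes covering ports of one
  vertex, which lie in a common row, and boxes covering a centre and one of its two ports.  Every
  edge therefore needs a box of its own for its centre, and this box covers at most one of the
  ports; the vertices whose rows serve the remaining ports form a vertex cover.  Hence the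
  optimum of the point set is the vertex cover number \<open>\<tau>\<close> plus the number \<open>m\<close> of edges, and a class
  cover of size \<open>k\<close> yields a vertex cover of size at most \<open>k - m\<close>.  As \<open>m \<le> d \<tau>\<close>, from
  \<open>k \<le> (1 + \<epsilon>) (\<tau> + m)\<close> follows \<open>k - m \<le> (1 + (d + 1) \<epsilon>) \<tau>\<close>.
\<close>

section \<open>Cost of programs\<close>

text \<open>The spacing is dictated by the gadget. An edge occupies the column offsets -1 to 3, so
  multiples of 5 keep edges apart. Modulo 4, ports lie in rows 0 and centres in rows 2, while blue
  points only take the residues 1, 2, 3: a row of ports carries no blue point. Columns of offset 1
  and 2 carry none either, so the box from a centre to its second port is never obstructed, however
  far apart the two rows are. Vertex labels serve directly as row numbers; they may be exponential
  in the input size, but coordinates are written in binary as well.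

  A cover returned by the approximation need not have any convenient form, and it is not normalised.
  The vertex selected for an edge is decided by one test on the returned boxes; the assignment of
  boxes to edges occurs only in the counting argument.

  The other obstacle is that the given program is a black box, known only through its runs from an
  initial state. It must run with the edge list stored beside its variables, and the size of its
  output is controlled by its cost alone.\<close>

lemma floorlog_le_self: "floorlog 2 k \<le> k"
proof (cases "k = 0")
  case False
  then have "k < 2 ^ k" by simp
  then show ?thesis by (simp add: floorlog_le_iff)
qed (simp add: floorlog_def)

lemma val_size_pos: "1 \<le> val_size v"
  by (cases v) auto

lemma val_size_Num_le: "val_size (Num z) \<le> 1 + nat \<bar>z\<bar>"
  using floorlog_le_self[of "nat \<bar>z\<bar>"] by simp

lemma floorlog_less: "k < 2 ^ floorlog 2 k"
  using floorlog_le_iff[of 2 k "floorlog 2 k"] by simp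

text \<open>A sum may be one bit longer than the longer summand; the unit in the size of the other
  summand pays for this carry.\<close>

lemma val_size_add: "val_size (Num (a + b)) \<le> val_size (Num a) + val_size (Num b)"
proof -
  let ?a = "nat \<bar>a\<bar>" and ?b = "nat \<bar>b\<bar>"
  let ?m = "max (floorlog 2 ?a) (floorlog 2 ?b)"
  have "?a < 2 ^ ?m" "?b < 2 ^ ?m"
    using floorlog_less[of ?a] floorlog_less[of ?b] power_increasing[of _ ?m "2::nat"]
    by (meson less_le_trans max.cobounded1 max.cobounded2 one_le_numeral)+
  moreover have "nat \<bar>a + b\<bar> \<le> ?a + ?b" by linarith
  ultimately have "nat \<bar>a + b\<bar> < 2 * 2 ^ ?m" by linarith
  then have "nat \<bar>a + b\<bar> < 2 ^ (?m + 1)" by simp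
  then have "floorlog 2 (nat \<bar>a + b\<bar>) \<le> ?m + 1" by (simp add: floorlog_le_iff)
  then show ?thesis
    by (simp add: max_def split: if_splits)
qed

lemma val_size_uminus: "val_size (Num (- a)) = val_size (Num a)"
  by simp

lemma val_size_diff: "val_size (Num (a - b)) \<le> val_size (Num a) + val_size (Num b)"
  using val_size_add[of a "- b"] by (simp only: val_size_uminus diff_conv_add_uminus)

lemma val_size_mult: "val_size (Num (a * b)) \<le> val_size (Num a) + val_size (Num b)"
proof -
  let ?a = "nat \<bar>a\<bar>" and ?b = "nat \<bar>b\<bar>"
  have "?a * ?b < 2 ^ floorlog 2 ?a * 2 ^ floorlog 2 ?b"
    by (rule mult_strict_mono[OF floorlog_less floorlog_less]) simp_all
  moreover have "nat \<bar>a * b\<bar> = ?a * ?b"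
    by (simp only: abs_mult nat_mult_distrib abs_ge_zero)
  ultimately have "nat \<bar>a * b\<bar> < 2 ^ (floorlog 2 ?a + floorlog 2 ?b)"
    by (simp only: power_add)
  then have "floorlog 2 (nat \<bar>a * b\<bar>) \<le> floorlog 2 ?a + floorlog 2 ?b"
    by (simp add: floorlog_le_iff)
  then show ?thesis by simp
qed

lemma val_size_fst: "val_size (val_fst v) \<le> val_size v"
  by (cases v) (simp_all add: floorlog_def)

lemma val_size_snd: "val_size (val_snd v) \<le> val_size v"
  by (cases v) (simp_all add: floorlog_def)

lemma val_size_int: "val_size (Num (val_int v)) \<le> val_size v"
  by (cases v) (auto simp: floorlog_def)

lemma val_size_bool: "val_size (val_bool P) \<le> 2"
  by (simp add: val_bool_def floorlog_def)

section \<open>Size and cost of expressions\<close>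

fun expr_vars :: "expr \<Rightarrow> nat set" where
  "expr_vars (Var x) = {x}"
| "expr_vars (Const k) = {}"
| "expr_vars (Fst e) = expr_vars e"
| "expr_vars (Snd e) = expr_vars e"
| "expr_vars (MkCell e f) = expr_vars e \<union> expr_vars f"
| "expr_vars (Plus e f) = expr_vars e \<union> expr_vars f"
| "expr_vars (Minus e f) = expr_vars e \<union> expr_vars f"
| "expr_vars (Times e f) = expr_vars e \<union> expr_vars f"
| "expr_vars (Less e f) = expr_vars e \<union> expr_vars f"
| "expr_vars (Equal e f) = expr_vars e \<union> expr_vars f"

text \<open>Sizes are subadditive under sum, difference and product, so a fixed expression enlarges
  its inputs by at most a constant factor, and this is the factor. The summand 2 is the size of a
  truth value and also pays for the node of a cell.\<close>

fun expr_weight :: "expr \<Rightarrow> nat" where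
  "expr_weight (Var x) = 1"
| "expr_weight (Const k) = val_size (Num k)"
| "expr_weight (Fst e) = expr_weight e"
| "expr_weight (Snd e) = expr_weight e"
| "expr_weight (MkCell e f) = 2 + expr_weight e + expr_weight f"
| "expr_weight (Plus e f) = 2 + expr_weight e + expr_weight f"
| "expr_weight (Minus e f) = 2 + expr_weight e + expr_weight f"
| "expr_weight (Times e f) = 2 + expr_weight e + expr_weight f"
| "expr_weight (Less e f) = 2 + expr_weight e + expr_weight f"
| "expr_weight (Equal e f) = 2 + expr_weight e + expr_weight f"

fun expr_cost_weight :: "expr \<Rightarrow> nat" where
  "expr_cost_weight (Var x) = expr_weight (Var x)"
| "expr_cost_weight (Const k) = expr_weight (Const k)"
| "expr_cost_weight (Fst e) = expr_weight (Fst e) + expr_cost_weight e"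
| "expr_cost_weight (Snd e) = expr_weight (Snd e) + expr_cost_weight e"
| "expr_cost_weight (MkCell e f) = expr_weight (MkCell e f) + expr_cost_weight e + expr_cost_weight f"
| "expr_cost_weight (Plus e f) = expr_weight (Plus e f) + expr_cost_weight e + expr_cost_weight f"
| "expr_cost_weight (Minus e f) = expr_weight (Minus e f) + expr_cost_weight e + expr_cost_weight f"
| "expr_cost_weight (Times e f) = expr_weight (Times e f) + expr_cost_weight e + expr_cost_weight f"
| "expr_cost_weight (Less e f) = expr_weight (Less e f) + expr_cost_weight e + expr_cost_weight f"
| "expr_cost_weight (Equal e f) = expr_weight (Equal e f) + expr_cost_weight e + expr_cost_weight f"

lemma val_size_eval_le:
  assumes "1 \<le> M" "\<And>x. x \<in> expr_vars e \<Longrightarrow> val_size (s x) \<le> M"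
  shows "val_size (eval e s) \<le> expr_weight e * M"
  using assms(2)
proof (induction e)
  case (Const k)
  show ?case using assms(1) mult_le_mono2[of 1 M "val_size (Num k)"] by simp
next
  case (Fst e)
  then show ?case using val_size_fst[of "eval e s"] by (simp add: le_trans)
next
  case (Snd e)
  then show ?case using val_size_snd[of "eval e s"] by (simp add: le_trans)
next
  case (MkCell e f)
  then have "val_size (eval e s) \<le> expr_weight e * M" "val_size (eval f s) \<le> expr_weight f * M"
    by auto
  then show ?case using assms(1) by (simp add: algebra_simps)
next
  case (Plus e f)
  then have "val_size (eval e s) \<le> expr_weight e * M" "val_size (eval f s) \<le> expr_weight f * M"
    by auto
  then show ?case
    using val_size_add[of "val_int (eval e s)" "val_int (eval f s)"]
      val_size_int[of "eval e s"] val_size_int[of "eval f s"]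
    unfolding eval.simps expr_weight.simps add_mult_distrib by linarith
next
  case (Minus e f)
  then have "val_size (eval e s) \<le> expr_weight e * M" "val_size (eval f s) \<le> expr_weight f * M"
    by auto
  then show ?case
    using val_size_diff[of "val_int (eval e s)" "val_int (eval f s)"]
      val_size_int[of "eval e s"] val_size_int[of "eval f s"]
    unfolding eval.simps expr_weight.simps add_mult_distrib by linarith
next
  case (Times e f)
  then have "val_size (eval e s) \<le> expr_weight e * M" "val_size (eval f s) \<le> expr_weight f * M"
    by auto
  then show ?case
    using val_size_mult[of "val_int (eval e s)" "val_int (eval f s)"]
      val_size_int[of "eval e s"] val_size_int[of "eval f s"]
    unfolding eval.simps expr_weight.simps add_mult_distrib by linarith
next
  case (Less e f)
  show ?case
    unfolding eval.simps expr_weight.simps add_mult_distrib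
    using assms(1) by (intro order.trans[OF val_size_bool]) linarith
next
  case (Equal e f)
  show ?case
    unfolding eval.simps expr_weight.simps add_mult_distrib
    using assms(1) by (intro order.trans[OF val_size_bool]) linarith
qed simp

lemma ecost_le:
  assumes "1 \<le> M" "\<And>x. x \<in> expr_vars e \<Longrightarrow> val_size (s x) \<le> M"
  shows "ecost e s \<le> expr_cost_weight e * M"
  using assms(2)
proof (induction e)
  case (Var x)
  then show ?case using val_size_eval_le[OF assms(1), of "Var x" s] by simp
next
  case (Const k)
  then show ?case using val_size_eval_le[OF assms(1), of "Const k" s] by simp
next
  case (Fst e)
  then have "val_size (eval (Fst e) s) \<le> expr_weight (Fst e) * M"
    "ecost e s \<le> expr_cost_weight e * M"
    by (auto intro!: val_size_eval_le[OF assms(1)] simp del: eval.simps expr_weight.simps ecost.simps)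
  then show ?case
    unfolding ecost.simps[of "Fst e"] expr_cost_weight.simps subcost.simps add_mult_distrib by linarith
next
  case (Snd e)
  then have "val_size (eval (Snd e) s) \<le> expr_weight (Snd e) * M"
    "ecost e s \<le> expr_cost_weight e * M"
    by (auto intro!: val_size_eval_le[OF assms(1)] simp del: eval.simps expr_weight.simps ecost.simps)
  then show ?case
    unfolding ecost.simps[of "Snd e"] expr_cost_weight.simps subcost.simps add_mult_distrib by linarith
next
  case (MkCell e f)
  then have "val_size (eval (MkCell e f) s) \<le> expr_weight (MkCell e f) * M"
    "ecost e s \<le> expr_cost_weight e * M" "ecost f s \<le> expr_cost_weight f * M"
    by (auto intro!: val_size_eval_le[OF assms(1)] simp del: eval.simps expr_weight.simps ecost.simps)
  then show ?case
    unfolding ecost.simps[of "MkCell e f"] expr_cost_weight.simps subcost.simps add_mult_distrib by linarith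
next
  case (Plus e f)
  then have "val_size (eval (Plus e f) s) \<le> expr_weight (Plus e f) * M"
    "ecost e s \<le> expr_cost_weight e * M" "ecost f s \<le> expr_cost_weight f * M"
    by (auto intro!: val_size_eval_le[OF assms(1)] simp del: eval.simps expr_weight.simps ecost.simps)
  then show ?case
    unfolding ecost.simps[of "Plus e f"] expr_cost_weight.simps subcost.simps add_mult_distrib by linarith
next
  case (Minus e f)
  then have "val_size (eval (Minus e f) s) \<le> expr_weight (Minus e f) * M"
    "ecost e s \<le> expr_cost_weight e * M" "ecost f s \<le> expr_cost_weight f * M"
    by (auto intro!: val_size_eval_le[OF assms(1)] simp del: eval.simps expr_weight.simps ecost.simps)
  then show ?case
    unfolding ecost.simps[of "Minus e f"] expr_cost_weight.simps subcost.simps add_mult_distrib by linarith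
next
  case (Times e f)
  then have "val_size (eval (Times e f) s) \<le> expr_weight (Times e f) * M"
    "ecost e s \<le> expr_cost_weight e * M" "ecost f s \<le> expr_cost_weight f * M"
    by (auto intro!: val_size_eval_le[OF assms(1)] simp del: eval.simps expr_weight.simps ecost.simps)
  then show ?case
    unfolding ecost.simps[of "Times e f"] expr_cost_weight.simps subcost.simps add_mult_distrib by linarith
next
  case (Less e f)
  then have "val_size (eval (Less e f) s) \<le> expr_weight (Less e f) * M"
    "ecost e s \<le> expr_cost_weight e * M" "ecost f s \<le> expr_cost_weight f * M"
    by (auto intro!: val_size_eval_le[OF assms(1)] simp del: eval.simps expr_weight.simps ecost.simps)
  then show ?case
    unfolding ecost.simps[of "Less e f"] expr_cost_weight.simps subcost.simps add_mult_distrib by linarith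
next
  case (Equal e f)
  then have "val_size (eval (Equal e f) s) \<le> expr_weight (Equal e f) * M"
    "ecost e s \<le> expr_cost_weight e * M" "ecost f s \<le> expr_cost_weight f * M"
    by (auto intro!: val_size_eval_le[OF assms(1)] simp del: eval.simps expr_weight.simps ecost.simps)
  then show ?case
    unfolding ecost.simps[of "Equal e f"] expr_cost_weight.simps subcost.simps add_mult_distrib by linarith
qed

lemma val_size_eval_le_ecost: "val_size (eval e s) \<le> ecost e s"
  by simp

lemma eval_subcost_cong:
  "(\<And>x. x \<in> expr_vars e \<Longrightarrow> s x = s' x) \<Longrightarrow>
    eval e s = eval e s' \<and> subcost e s = subcost e s'"
  by (induction e) auto

lemma eval_cong: "(\<And>x. x \<in> expr_vars e \<Longrightarrow> s x = s' x) \<Longrightarrow> eval e s = eval e s'"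
  using eval_subcost_cong by blast

lemma ecost_cong: "(\<And>x. x \<in> expr_vars e \<Longrightarrow> s x = s' x) \<Longrightarrow> ecost e s = ecost e s'"
  using eval_subcost_cong[of e s s'] by simp

section \<open>Variables of a program and independence of the others\<close>

fun com_vars :: "com \<Rightarrow> nat set" where
  "com_vars Skip = {}"
| "com_vars (Assign x e) = insert x (expr_vars e)"
| "com_vars (Seq c d) = com_vars c \<union> com_vars d"
| "com_vars (Cond e c d) = expr_vars e \<union> com_vars c \<union> com_vars d"
| "com_vars (While e c) = expr_vars e \<union> com_vars c"

lemma finite_com_vars: "finite (com_vars c)"
proof (induction c)
  case (Assign x e) show ?case by simp (induction e; simp)
next
  case (Cond e c d)
  have "finite (expr_vars e)" by (induction e) auto
  with Cond show ?case by simp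
next
  case (While e c)
  have "finite (expr_vars e)" by (induction e) auto
  with While show ?case by simp
qed auto

text \<open>An assignment pays for the size of the value that it stores. This is the only available
  bound on the output of the given program.\<close>

lemma exec_val_size: "exec c s t s' \<Longrightarrow> val_size (s' x) \<le> val_size (s x) + t"
proof (induction rule: exec.induct)
  case (Assign y e s)
  then show ?case using val_size_eval_le_ecost[of e s] by (cases "x = y") auto
qed auto

text \<open>Results and costs depend only on the variables read, so a run known from an initial
  state can be repeated, at equal cost, in a state that holds further data elsewhere.\<close>

lemma exec_frame:
  assumes "exec c s t s'" "com_vars c \<subseteq> V" "\<forall>x\<in>V. r x = s x"
  shows "\<exists>r'. exec c r t r' \<and> (\<forall>x\<in>V. r' x = s' x) \<and> (\<forall>x. x \<notin> V \<longrightarrow> r' x = r x)"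
  using assms
proof (induction arbitrary: r rule: exec.induct)
  case (Skip s)
  then show ?case by (intro exI[of _ r] conjI exec.Skip) auto
next
  case (Assign y e s)
  have *: "eval e r = eval e s" "ecost e r = ecost e s"
    using Assign.prems by (auto intro!: eval_cong ecost_cong simp del: ecost.simps)
  show ?case
    using exec.Assign[of y e r] Assign.prems unfolding *
    by (intro exI[of _ "r(y := eval e s)"] conjI) (simp_all del: fun_upd_apply, auto)
next
  case (Seq c s t s' d t' s'')
  from Seq.IH(1)[of r] Seq.prems obtain r' where
    1: "exec c r t r'" "\<forall>x\<in>V. r' x = s' x" "\<forall>x. x \<notin> V \<longrightarrow> r' x = r x" by auto
  from Seq.IH(2)[of r'] Seq.prems 1(2) obtain r'' where
    2: "exec d r' t' r''" "\<forall>x\<in>V. r'' x = s'' x" "\<forall>x. x \<notin> V \<longrightarrow> r'' x = r' x" by auto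
  show ?case using exec.Seq[OF 1(1) 2(1)] 1 2 by auto
next
  case (CondTrue e s c t s' d)
  have *: "eval e r = eval e s" "ecost e r = ecost e s"
    using CondTrue.prems by (auto intro!: eval_cong ecost_cong simp del: ecost.simps)
  from CondTrue.IH[of r] CondTrue.prems obtain r' where
    "exec c r t r'" "\<forall>x\<in>V. r' x = s' x" "\<forall>x. x \<notin> V \<longrightarrow> r' x = r x" by auto
  with exec.CondTrue[of e r c t r' d] CondTrue(1) show ?case unfolding * by metis
next
  case (CondFalse e s d t s' c)
  have *: "eval e r = eval e s" "ecost e r = ecost e s"
    using CondFalse.prems by (auto intro!: eval_cong ecost_cong simp del: ecost.simps)
  from CondFalse.IH[of r] CondFalse.prems obtain r' where
    "exec d r t r'" "\<forall>x\<in>V. r' x = s' x" "\<forall>x. x \<notin> V \<longrightarrow> r' x = r x" by auto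
  with exec.CondFalse[of e r d t r' c] CondFalse(1) show ?case unfolding * by metis
next
  case (WhileFalse e s c)
  have *: "eval e r = eval e s" "ecost e r = ecost e s"
    using WhileFalse.prems by (auto intro!: eval_cong ecost_cong simp del: ecost.simps)
  show ?case using exec.WhileFalse[of e r c] WhileFalse unfolding * by metis
next
  case (WhileTrue e s c t s' t' s'')
  have *: "eval e r = eval e s" "ecost e r = ecost e s"
    using WhileTrue.prems by (auto intro!: eval_cong ecost_cong simp del: ecost.simps)
  from WhileTrue.IH(1)[of r] WhileTrue.prems obtain r' where
    1: "exec c r t r'" "\<forall>x\<in>V. r' x = s' x" "\<forall>x. x \<notin> V \<longrightarrow> r' x = r x" by auto
  from WhileTrue.IH(2)[of r'] WhileTrue.prems 1(2) obtain r'' where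
    2: "exec (While e c) r' t' r''" "\<forall>x\<in>V. r'' x = s'' x" "\<forall>x. x \<notin> V \<longrightarrow> r'' x = r' x" by auto
  have "exec (While e c) r (1 + ecost e s + t + t') r''"
    using exec.WhileTrue[of e r c t r' t' r''] WhileTrue(1) 1(1) 2(1) unfolding * .
  then show ?case using 1 2 by (intro exI[of _ r''] conjI) auto
qed

section \<open>Cost-bounded runs: loop-free commands and loops over lists\<close>

definition runs :: "com \<Rightarrow> state \<Rightarrow> nat \<Rightarrow> (state \<Rightarrow> bool) \<Rightarrow> bool" where
  "runs c s T Q \<longleftrightarrow> (\<exists>t s'. exec c s t s' \<and> t \<le> T \<and> Q s')"

lemma runs_mono: "runs c s T Q \<Longrightarrow> T \<le> T' \<Longrightarrow> (\<And>s'. Q s' \<Longrightarrow> Q' s') \<Longrightarrow> runs c s T' Q'"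
  unfolding runs_def by (meson le_trans)

lemma runs_Seq: "runs c s T (\<lambda>s'. runs d s' T' Q) \<Longrightarrow> runs (Seq c d) s (1 + T + T') Q"
  unfolding runs_def by (meson add_le_mono exec.Seq le_refl)

fun loop_free :: "com \<Rightarrow> bool" where
  "loop_free (Seq c d) = (loop_free c \<and> loop_free d)"
| "loop_free (Cond e c d) = (loop_free c \<and> loop_free d)"
| "loop_free (While e c) = False"
| "loop_free _ = True"

text \<open>\<open>While\<close> falls under the default clause, where the value is meaningless;
  \<open>exec_loop_free\<close> therefore assumes \<open>loop_free\<close>.\<close>

fun result :: "com \<Rightarrow> state \<Rightarrow> state" where
  "result (Assign x e) s = s(x := eval e s)"
| "result (Seq c d) s = result d (result c s)"
| "result (Cond e c d) s = (if eval e s = Num 0 then result d s else result c s)"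
| "result _ s = s"

fun com_weight :: "com \<Rightarrow> nat" where
  "com_weight (Assign x e) = 1 + expr_cost_weight e + expr_weight e"
| "com_weight (Seq c d) = 1 + com_weight c + com_weight d * com_weight c"
| "com_weight (Cond e c d) = 1 + expr_cost_weight e + com_weight c + com_weight d"
| "com_weight _ = 1"

lemma com_weight_pos: "1 \<le> com_weight c"
  by (induction c) auto

text \<open>The values grow by at most a constant factor, so the second command of a sequence still
  meets values of size linear in \<open>M\<close>.\<close>

lemma exec_loop_free:
  assumes "loop_free c" "1 \<le> M" "com_vars c \<subseteq> V" "\<And>x. x \<in> V \<Longrightarrow> val_size (s x) \<le> M"
  shows "(\<exists>t \<le> com_weight c * M. exec c s t (result c s)) \<and>
    (\<forall>x\<in>V. val_size (result c s x) \<le> com_weight c * M)"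
  using assms
proof (induction c arbitrary: s M)
  case Skip
  then show ?case using exec.Skip[of s] by auto
next
  case (Assign y e)
  have b: "ecost e s \<le> expr_cost_weight e * M" "val_size (eval e s) \<le> expr_weight e * M"
    using Assign by (auto intro!: ecost_le val_size_eval_le simp del: ecost.simps)
  have "exec (Assign y e) s (1 + ecost e s) (result (Assign y e) s)"
    using exec.Assign by simp
  moreover have "1 + ecost e s \<le> com_weight (Assign y e) * M"
    using b(1) Assign.prems(2) by (simp add: add_mult_distrib del: ecost.simps)
  moreover have "val_size (result (Assign y e) s x) \<le> com_weight (Assign y e) * M" if "x \<in> V" for x
    using b(2) Assign.prems(4)[OF that] by (auto simp: add_mult_distrib)
  ultimately show ?case by blast
next
  case (Seq c d)
  let ?M = "com_weight c * M"
  have M: "1 \<le> ?M" using com_weight_pos[of c] Seq.prems(2) by (metis mult_le_mono nat_mult_1)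
  have 1: "(\<exists>t \<le> ?M. exec c s t (result c s)) \<and> (\<forall>x\<in>V. val_size (result c s x) \<le> ?M)"
    by (rule Seq.IH(1)) (use Seq.prems in auto)
  have 2: "(\<exists>t \<le> com_weight d * ?M. exec d (result c s) t (result d (result c s))) \<and>
      (\<forall>x\<in>V. val_size (result d (result c s) x) \<le> com_weight d * ?M)"
    by (rule Seq.IH(2)) (use Seq.prems M 1 in auto)
  from 1 2 obtain t u where "t \<le> ?M" "exec c s t (result c s)" "u \<le> com_weight d * ?M"
    "exec d (result c s) u (result d (result c s))" by blast
  then have "exec (Seq c d) s (1 + t + u) (result (Seq c d) s)"
    "1 + t + u \<le> com_weight (Seq c d) * M"
    using Seq.prems(2) exec.Seq by (auto simp: algebra_simps)
  moreover have "com_weight d * ?M \<le> com_weight (Seq c d) * M"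
    by (simp add: algebra_simps)
  ultimately show ?case using 2 by (metis le_trans result.simps(2))
next
  case (Cond e c d)
  have b: "ecost e s \<le> expr_cost_weight e * M"
    using Cond.prems by (auto intro!: ecost_le simp del: ecost.simps)
  have 1: "(\<exists>t \<le> com_weight c * M. exec c s t (result c s)) \<and>
      (\<forall>x\<in>V. val_size (result c s x) \<le> com_weight c * M)"
    by (rule Cond.IH(1)) (use Cond.prems in auto)
  have 2: "(\<exists>t \<le> com_weight d * M. exec d s t (result d s)) \<and>
      (\<forall>x\<in>V. val_size (result d s x) \<le> com_weight d * M)"
    by (rule Cond.IH(2)) (use Cond.prems in auto)
  show ?case
  proof (cases "eval e s = Num 0")
    case True
    from 2 obtain t where "t \<le> com_weight d * M" "exec d s t (result d s)" by blast
    then have "exec (Cond e c d) s (1 + ecost e s + t) (result (Cond e c d) s)"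
      "1 + ecost e s + t \<le> com_weight (Cond e c d) * M"
      using exec.CondFalse[OF True] True b Cond.prems(2)
      by (auto simp add: add_mult_distrib simp del: ecost.simps)
    moreover have "com_weight d * M \<le> com_weight (Cond e c d) * M"
      by (simp add: algebra_simps)
    ultimately show ?thesis using 2 True by (metis le_trans result.simps(3))
  next
    case False
    from 1 obtain t where "t \<le> com_weight c * M" "exec c s t (result c s)" by blast
    then have "exec (Cond e c d) s (1 + ecost e s + t) (result (Cond e c d) s)"
      "1 + ecost e s + t \<le> com_weight (Cond e c d) * M"
      using exec.CondTrue[OF False] False b Cond.prems(2)
      by (auto simp add: add_mult_distrib simp del: ecost.simps)
    moreover have "com_weight c * M \<le> com_weight (Cond e c d) * M"
      by (simp add: algebra_simps)
    ultimately show ?thesis using 1 False by (metis le_trans result.simps(3))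
  qed
qed simp

lemma runs_loop_free:
  assumes "loop_free c" "1 \<le> M" "\<forall>x\<in>com_vars c. val_size (s x) \<le> M" "Q (result c s)"
  shows "runs c s (com_weight c * M) Q"
  using exec_loop_free[of c M "com_vars c" s] assms unfolding runs_def by blast

lemma val_list_simps [simp]: "val_list [] = Num 0" "val_list (v # vs) = Cell v (val_list vs)"
  by (simp_all add: val_list_def)

lemma val_size_val_list_le:
  assumes "\<And>v. v \<in> set vs \<Longrightarrow> val_size v \<le> A"
  shows "val_size (val_list vs) \<le> 1 + length vs * (1 + A)"
  using assms
proof (induction vs)
  case (Cons v vs)
  then have "val_size (val_list vs) \<le> 1 + length vs * (1 + A)" "val_size v \<le> A" by auto
  then show ?case by simp
qed (simp add: floorlog_def)

lemma val_size_member: "v \<in> set vs \<Longrightarrow> val_size v \<le> val_size (val_list vs)"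
  by (induction vs) auto

lemma length_le_val_size: "length vs \<le> val_size (val_list vs)"
  by (induction vs) auto

lemma val_size_val_list_drop: "val_size (val_list (drop k vs)) \<le> val_size (val_list vs)"
proof (induction vs arbitrary: k)
  case (Cons v vs)
  show ?case using Cons[of "k - 1"] by (cases k) auto
qed simp

text \<open>The empty list is \<open>Num 0\<close>, the only tree that counts as false, so the
  variable holding the unprocessed rest serves as the loop test. The induction runs downwards from
  the end of the list; the summand 1 in \<open>length vs + 1\<close> is for the final, failing
  test.\<close>

lemma runs_While_list:
  assumes list: "\<And>k s. k \<le> length vs \<Longrightarrow> Inv k s \<Longrightarrow> s l = val_list (drop k vs)"
    and step: "\<And>k s. k < length vs \<Longrightarrow> Inv k s \<Longrightarrow> runs c s K (Inv (Suc k))"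
    and size: "val_size (val_list vs) \<le> M"
    and init: "Inv 0 s"
  shows "runs (While (Var l) c) s ((length vs + 1) * (1 + M + K)) (Inv (length vs))"
proof -
  have cost: "ecost (Var l) r \<le> M" if "k \<le> length vs" "Inv k r" for k r
    using list[OF that] val_size_val_list_drop[of k vs] size by simp
  have "runs (While (Var l) c) r ((length vs - k + 1) * (1 + M + K)) (Inv (length vs))"
    if "k \<le> length vs" "Inv k r" for k r
    using that
  proof (induction arbitrary: r rule: inc_induct)
    case base
    then have "exec (While (Var l) c) r (1 + ecost (Var l) r) r"
      using list[of "length vs" r] by (intro exec.WhileFalse) auto
    then show ?case using cost[OF _ base] base unfolding runs_def by fastforce
  next
    case (step k)
    then have "k < length vs" by simp
    with step.prems assms(2) obtain t r' where 1: "exec c r t r'" "t \<le> K" "Inv (Suc k) r'"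
      unfolding runs_def by blast
    with step.IH obtain u r'' where 2: "exec (While (Var l) c) r' u r''"
      "u \<le> (length vs - Suc k + 1) * (1 + M + K)" "Inv (length vs) r''"
      unfolding runs_def by blast
    have "eval (Var l) r \<noteq> Num 0"
      using list[of k r] step.prems \<open>k < length vs\<close> by (simp flip: Cons_nth_drop_Suc)
    then have "exec (While (Var l) c) r (1 + ecost (Var l) r + t + u) r''"
      using 1 2 exec.WhileTrue by blast
    moreover have "1 + ecost (Var l) r + t + u \<le> (length vs - k + 1) * (1 + M + K)"
    proof -
      have "length vs - k + 1 = Suc (length vs - Suc k + 1)" using \<open>k < length vs\<close> by simp
      then show ?thesis
        using 1(2) 2(2) cost[of k r] step.prems \<open>k < length vs\<close> by (simp del: ecost.simps)
    qed
    ultimately show ?case using 2(3) unfolding runs_def by blast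
  qed
  from this[of 0 s] init show ?thesis by simp
qed

section \<open>Polynomial functions on the natural numbers\<close>

definition is_poly :: "(nat \<Rightarrow> nat) \<Rightarrow> bool" where
  "is_poly f \<longleftrightarrow> (\<exists>p. \<forall>n. f n = poly p n)"

lemma is_poly_id: "is_poly (\<lambda>n. n)"
  unfolding is_poly_def by (rule exI[of _ "[:0, 1:]"]) simp

lemma is_poly_const: "is_poly (\<lambda>n. a)"
  unfolding is_poly_def by (rule exI[of _ "[:a:]"]) simp

lemma is_poly_add: "is_poly f \<Longrightarrow> is_poly g \<Longrightarrow> is_poly (\<lambda>n. f n + g n)"
  unfolding is_poly_def by (metis poly_add)

lemma is_poly_mult: "is_poly f \<Longrightarrow> is_poly g \<Longrightarrow> is_poly (\<lambda>n. f n * g n)"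
  unfolding is_poly_def by (metis poly_mult)

lemma is_poly_poly: "is_poly f \<Longrightarrow> is_poly (\<lambda>n. poly p (f n))"
  unfolding is_poly_def by (metis poly_pcompose)

lemmas is_poly_intros = is_poly_id is_poly_const is_poly_add is_poly_mult is_poly_poly

text \<open>The coefficients are natural numbers, hence nonnegative. Monotonicity allows the cost of
  the given program to be estimated from a mere upper bound on the size of its input.\<close>

lemma poly_nat_mono: "m \<le> n \<Longrightarrow> poly p m \<le> poly p (n :: nat)"
  by (induction p) (auto intro: add_mono mult_mono)

section \<open>The point set of a graph\<close>

text \<open>A shape \<open>(x, q, y)\<close> stands for the point with offsets \<open>x\<close>, \<open>y\<close> from the columns of
  its edge and from the row of the second (\<open>q\<close>) or first endpoint.\<close>

definition shape_point :: "nat \<Rightarrow> nat \<times> nat \<Rightarrow> int \<times> bool \<times> int \<Rightarrow> int \<times> int" where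
  "shape_point e uw = (\<lambda>(x, q, y). (5 * int e + x, 4 * int (if q then snd uw else fst uw) + y))"

definition red_shapes :: "(int \<times> bool \<times> int) list" where
  "red_shapes = [(0, False, 0), (1, False, 2), (2, True, 0)]"

text \<open>Columns -1 and 3 fence an edge off from the others: the points one row above an endpoint
  separate ports lying in different rows, those in the row of the centre isolate the centre. The
  last two points separate the two ports of the edge, one for each order of the endpoints.\<close>

definition blue_shapes :: "(int \<times> bool \<times> int) list" where
  "blue_shapes =
    [(-1, False, 1), (-1, False, 2), (-1, True, 1), (3, False, 1), (3, False, 2), (3, True, 1),
     (0, False, 3), (0, False, -1)]"

text \<open>The last edge comes first because the program prepends the points of each edge to those
  already produced.\<close>

definition points :: "(int \<times> bool \<times> int) list \<Rightarrow> (nat \<times> nat) list \<Rightarrow> nat \<Rightarrow> (int \<times> int) list" where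
  "points shapes es k = concat (map (\<lambda>e. map (shape_point e (es ! e)) shapes) (rev [0..<k]))"

lemma points_simps:
  "points shapes es 0 = []"
  "points shapes es (Suc k) = map (shape_point k (es ! k)) shapes @ points shapes es k"
  by (simp_all add: points_def)

lemma set_points: "set (points shapes es k) = (\<Union>e<k. shape_point e (es ! e) ` set shapes)"
  by (auto simp: points_def)

lemma length_points: "length (points shapes es k) = k * length shapes"
  by (induction k) (simp_all add: points_simps)

text \<open>The offsets -1 to 3 are pairwise incongruent modulo 5.\<close>

lemma shape_point_column:
  "\<lbrakk>shape_point e a (x, q, y) = shape_point e' b (x', q', y');
    -1 \<le> x; x \<le> 3; -1 \<le> x'; x' \<le> 3\<rbrakk> \<Longrightarrow> e = e'"
  unfolding shape_point_def by (simp split del: if_split)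

text \<open>The encoding of a set must list its elements without repetition. Points of different
  edges differ in their columns, so only the points of a single edge have to be compared.\<close>

lemma distinct_points:
  assumes "\<And>x q y. (x, q, y) \<in> set shapes \<Longrightarrow> -1 \<le> x \<and> x \<le> 3"
    and "\<And>e. e < k \<Longrightarrow> distinct (map (shape_point e (es ! e)) shapes)"
  shows "distinct (points shapes es k)"
  using assms(2)
proof (induction k)
  case (Suc k)
  have "shape_point k (es ! k) s \<noteq> shape_point e (es ! e) s'"
    if "e < k" "s \<in> set shapes" "s' \<in> set shapes" for e s s'
    using shape_point_column[of k "es ! k" "fst s" "fst (snd s)" "snd (snd s)" e "es ! e"
        "fst s'" "fst (snd s')" "snd (snd s')"] assms(1)[of "fst s" "fst (snd s)" "snd (snd s)"]
      assms(1)[of "fst s'" "fst (snd s')" "snd (snd s')"] that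
    by auto
  then have "set (map (shape_point k (es ! k)) shapes) \<inter> set (points shapes es k) = {}"
    unfolding set_points by fastforce
  with Suc show ?case by (simp add: points_simps)
qed (simp add: points_simps)

section \<open>Boxes and lattice points\<close>

definition real_point :: "int \<times> int \<Rightarrow> real \<times> real" where
  "real_point = (\<lambda>(x, y). (of_int x, of_int y))"

lemma real_point_Pair: "real_point (x, y) = (of_int x, of_int y)"
  by (simp add: real_point_def)

lemma inj_real_point: "inj real_point"
  by (auto simp: inj_def real_point_def)

lemma covers_cbox:
  "covers (cbox p q) r \<longleftrightarrow> fst p < fst r \<and> fst r < fst q \<and> snd p < snd r \<and> snd r < snd q"
proof -
  have "interior (cbox p q) = box (fst p) (fst q) \<times> box (snd p) (snd q)"
    by (metis box_prod interior_cbox)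
  then show ?thesis by (cases r) (simp add: covers_def)
qed

text \<open>The interior of a box is a product of open intervals, so it contains the bounding
  rectangle of any two of its points. To show that no admissible box covers two given red points, it
  suffices to find a blue point in that rectangle.\<close>

lemma covers_between:
  assumes "is_box X" "covers X (real_point (a, b))" "covers X (real_point (a', b'))"
    "min a a' \<le> c" "c \<le> max a a'" "min b b' \<le> d" "d \<le> max b b'"
  shows "covers X (real_point (c, d))"
proof -
  obtain p q where X: "X = cbox p q" using assms(1) unfolding is_box_def by blast
  have "min (real_of_int a) (real_of_int a') \<le> real_of_int c" "real_of_int c \<le> max (real_of_int a) (real_of_int a')"
    "min (real_of_int b) (real_of_int b') \<le> real_of_int d" "real_of_int d \<le> max (real_of_int b) (real_of_int b')"
    using assms(4-7) by linarith+
  then show ?thesis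
    using assms(2,3) unfolding X covers_cbox real_point_Pair fst_conv snd_conv by linarith
qed

text \<open>The margin of one half puts the lattice points of the given range into the interior,
  admits no others, and keeps the interior non-empty when the range is a single row or
  column.\<close>

definition int_box :: "int \<Rightarrow> int \<Rightarrow> int \<Rightarrow> int \<Rightarrow> (real \<times> real) set" where
  "int_box a b c d = cbox (of_int a - 1/2, of_int c - 1/2) (of_int b + 1/2, of_int d + 1/2)"

lemma covers_int_box: "covers (int_box a b c d) (real_point (x, y)) \<longleftrightarrow> a \<le> x \<and> x \<le> b \<and> c \<le> y \<and> y \<le> d"
  unfolding int_box_def covers_cbox real_point_Pair fst_conv snd_conv by linarith

lemma is_box_int_box:
  assumes "a \<le> b" "c \<le> d" shows "is_box (int_box a b c d)"
proof -
  have "covers (int_box a b c d) (real_point (a, c))" using assms by (simp add: covers_int_box)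
  then show ?thesis unfolding covers_def is_box_def int_box_def by blast
qed

definition point_sets :: "(nat \<times> nat) list \<Rightarrow> (real \<times> real) set \<times> (real \<times> real) set" where
  "point_sets es = (real_point ` set (points red_shapes es (length es)),
    real_point ` set (points blue_shapes es (length es)))"

section \<open>Red points that a single box can cover\<close>

locale edge_list =
  fixes es :: "(nat \<times> nat) list"
  assumes loopless: "e < length es \<Longrightarrow> fst (es ! e) \<noteq> snd (es ! e)"
begin

definition "endpoint e q = (if q then snd (es ! e) else fst (es ! e))"

definition port :: "nat \<Rightarrow> bool \<Rightarrow> int \<times> int" where
  "port e q = (5 * int e + (if q then 2 else 0), 4 * int (endpoint e q))"

definition centre :: "nat \<Rightarrow> int \<times> int" where
  "centre e = (5 * int e + 1, 4 * int (endpoint e False) + 2)"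

definition free :: "(real \<times> real) set \<Rightarrow> bool" where
  "free X \<longleftrightarrow> is_box X \<and> (\<forall>b\<in>snd (point_sets es). \<not> covers X b)"

lemma reds: "fst (point_sets es) = real_point ` (\<Union>e<length es. {port e False, centre e, port e True})"
  unfolding point_sets_def set_points fst_conv
  by (simp add: red_shapes_def shape_point_def port_def centre_def endpoint_def)

lemma blues:
  "snd (point_sets es) = real_point ` (\<Union>e<length es.
    {(5 * int e - 1, 4 * int (endpoint e False) + 1), (5 * int e - 1, 4 * int (endpoint e False) + 2),
     (5 * int e - 1, 4 * int (endpoint e True) + 1), (5 * int e + 3, 4 * int (endpoint e False) + 1),
     (5 * int e + 3, 4 * int (endpoint e False) + 2), (5 * int e + 3, 4 * int (endpoint e True) + 1),
     (5 * int e, 4 * int (endpoint e False) + 3), (5 * int e, 4 * int (endpoint e False) - 1)})"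
  unfolding point_sets_def set_points snd_conv
  by (simp add: blue_shapes_def shape_point_def endpoint_def)

lemma freeD:
  assumes "free X" "e < length es"
  shows "\<not> covers X (real_point (5 * int e - 1, 4 * int (endpoint e q) + 1))"
    "\<not> covers X (real_point (5 * int e + 3, 4 * int (endpoint e q) + 1))"
    "\<not> covers X (real_point (5 * int e - 1, 4 * int (endpoint e False) + 2))"
    "\<not> covers X (real_point (5 * int e + 3, 4 * int (endpoint e False) + 2))"
    "\<not> covers X (real_point (5 * int e, 4 * int (endpoint e False) + 3))"
    "\<not> covers X (real_point (5 * int e, 4 * int (endpoint e False) - 1))"
  using assms by (cases q; auto simp: free_def blues)+

text \<open>The rows of the two ports differ by at least 4. If the second port is the higher one,
  the blue point three rows above the first port lies in their rectangle; otherwise the one just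
  below the first port does.\<close>

lemma not_both_ports:
  assumes "free X" "e < length es" "covers X (real_point (port e False))" "covers X (real_point (port e True))"
  shows False
proof -
  note b = covers_between[OF _ assms(3,4)[unfolded port_def if_True if_False]]
  have X: "is_box X" using assms(1) by (simp add: free_def)
  consider "endpoint e False < endpoint e True" | "endpoint e True < endpoint e False"
    using loopless[OF assms(2)] unfolding endpoint_def by (metis linorder_less_linear)
  then show False
  proof cases
    case 1
    then show False using b[OF X, of "5 * int e" "4 * int (endpoint e False) + 3"] freeD(5)[OF assms(1,2)] by simp
  next
    case 2
    then show False using b[OF X, of "5 * int e" "4 * int (endpoint e False) - 1"] freeD(6)[OF assms(1,2)] by simp
  qed
qed

text \<open>On the way to the columns of another edge the box would have to pass column -1 or 3 of
  edge \<open>e\<close>, where a blue point lies in the same row as the centre.\<close>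

lemma centre_isolated:
  assumes "free X" "e < length es" "covers X (real_point (centre e))"
    "e' \<noteq> e" "covers X (real_point (5 * int e' + x, y))" "0 \<le> x" "x \<le> 2"
  shows False
proof -
  note b = covers_between[OF _ assms(3,5)[unfolded centre_def]]
  have X: "is_box X" using assms(1) by (simp add: free_def)
  consider "e' < e" | "e < e'" using assms(4) by linarith
  then show False
  proof cases
    case 1
    then show False using b[OF X, of "5 * int e - 1" "4 * int (endpoint e False) + 2"]
      freeD(3)[OF assms(1,2)] assms(6,7) by linarith
  next
    case 2
    then show False using b[OF X, of "5 * int e + 3" "4 * int (endpoint e False) + 2"]
      freeD(4)[OF assms(1,2)] assms(6,7) by linarith
  qed
qed

text \<open>If the other port were higher, the rectangle would contain the blue point one row above
  the lower port, in the fence column on the side of the other edge. Such points lie only above a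
  row, so the statement is one-sided; exchanging the edges gives equality.\<close>

lemma ports_not_above:
  assumes "free X" "e < length es" "e \<noteq> e'"
    "covers X (real_point (port e q))" "covers X (real_point (port e' q'))"
  shows "endpoint e' q' \<le> endpoint e q"
proof (rule ccontr)
  assume less: "\<not> ?thesis"
  note b = covers_between[OF _ assms(4,5)[unfolded port_def]]
  have X: "is_box X" using assms(1) by (simp add: free_def)
  have q: "0 \<le> (if p then 2 else 0 :: int)" "(if p then 2 else 0 :: int) \<le> 2" for p
    by simp_all
  consider "e' < e" | "e < e'" using assms(3) by linarith
  then show False
  proof cases
    case 1
    then show False using b[OF X, of "5 * int e - 1" "4 * int (endpoint e q) + 1"]
      freeD(1)[OF assms(1,2), of q] less q[of q] q[of q'] by linarith
  next
    case 2
    then show False using b[OF X, of "5 * int e + 3" "4 * int (endpoint e q) + 1"]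
      freeD(2)[OF assms(1,2), of q] less q[of q] q[of q'] by linarith
  qed
qed

lemma ports_same_endpoint:
  assumes "free X" "e < length es" "e' < length es" "e \<noteq> e'"
    "covers X (real_point (port e q))" "covers X (real_point (port e' q'))"
  shows "endpoint e q = endpoint e' q'"
  using ports_not_above[OF assms(1,2,4,5,6)] ports_not_above[OF assms(1,3) _ assms(6,5)] assms(4)
  by simp

text \<open>If one box takes the centre together with the first port, the second port is the one
  left over, and the second endpoint is selected; otherwise the first. The test refers to the whole
  cover, so evaluating it requires no matching of boxes with edges.\<close>

definition served :: "(real \<times> real) set set \<Rightarrow> nat \<Rightarrow> bool" where
  "served T e \<longleftrightarrow> (\<exists>X\<in>T. covers X (real_point (centre e)) \<and> covers X (real_point (port e False)))"

definition chosen :: "(real \<times> real) set set \<Rightarrow> nat set" where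
  "chosen T = (\<lambda>e. endpoint e (served T e)) ` {..<length es}"

text \<open>For every edge put one box covering its centre aside, if possible one covering the first
  port as well.  These boxes are pairwise distinct and none of them covers the port selected for
  any edge, and each of the other boxes covers selected ports of a single vertex only.\<close>

lemma card_chosen:
  assumes T: "class_cover (point_sets es) T"
  shows "card (chosen T) + length es \<le> card T"
proof -
  let ?A = "{..<length es}"
  obtain R B where RB: "point_sets es = (R, B)" by fastforce
  have fin: "finite T" and free: "\<And>X. X \<in> T \<Longrightarrow> free X"
    and cov: "\<And>r. r \<in> fst (point_sets es) \<Longrightarrow> \<exists>X\<in>T. covers X r"
    using T unfolding class_cover_def RB free_def by auto
  have "\<forall>e\<in>?A. \<exists>X\<in>T. covers X (real_point (centre e)) \<and>
      (served T e \<longrightarrow> covers X (real_point (port e False)))"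
  proof
    fix e assume "e \<in> ?A"
    then have "real_point (centre e) \<in> fst (point_sets es)" unfolding reds by blast
    from cov[OF this] show "\<exists>X\<in>T. covers X (real_point (centre e)) \<and>
      (served T e \<longrightarrow> covers X (real_point (port e False)))" unfolding served_def by blast
  qed
  then obtain f where f: "\<And>e. e \<in> ?A \<Longrightarrow> f e \<in> T"
    "\<And>e. e \<in> ?A \<Longrightarrow> covers (f e) (real_point (centre e))"
    "\<And>e. e \<in> ?A \<Longrightarrow> served T e \<Longrightarrow> covers (f e) (real_point (port e False))"
    by metis
  have "\<forall>e\<in>?A. \<exists>X\<in>T. covers X (real_point (port e (served T e)))"
  proof
    fix e assume "e \<in> ?A"
    then have "real_point (port e (served T e)) \<in> fst (point_sets es)" unfolding reds
      by (cases "served T e") auto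
    from cov[OF this] show "\<exists>X\<in>T. covers X (real_point (port e (served T e)))" .
  qed
  then obtain g where g: "\<And>e. e \<in> ?A \<Longrightarrow> g e \<in> T"
    "\<And>e. e \<in> ?A \<Longrightarrow> covers (g e) (real_point (port e (served T e)))"
    by metis
  have port: "\<exists>x. 0 \<le> x \<and> x \<le> 2 \<and> port e q = (5 * int e + x, 4 * int (endpoint e q))" for e q
    by (auto simp: port_def)
  have inj: "inj_on f ?A"
  proof (rule inj_onI, rule ccontr)
    fix e e' assume *: "e \<in> ?A" "e' \<in> ?A" "f e = f e'" "e \<noteq> e'"
    then show False
      using centre_isolated[of "f e" e e' 1 "4 * int (endpoint e' False) + 2"] f[of e] f(2)[of e']
        free[of "f e"] by (simp add: centre_def)
  qed
  \<comment> \<open>For different edges this is the isolation of the centre. For the same edge: if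
    it is served, the box would cover both ports; if not, the box would cover the centre and the
    first port, which makes the edge served.\<close>
  have "g e \<noteq> f e'" if "e \<in> ?A" "e' \<in> ?A" for e e'
  proof
    assume eq: "g e = f e'"
    have fr: "free (f e')" using f that free by blast
    show False
    proof (cases "e' = e")
      case False
      obtain x where "0 \<le> x" "x \<le> 2" "port e (served T e) = (5 * int e + x, 4 * int (endpoint e (served T e)))"
        using port by blast
      then show False
        using centre_isolated[OF fr _ f(2)[OF that(2)], of e x] that False g(2)[OF that(1)] eq by auto
    next
      case True
      show False
      proof (cases "served T e")
        case True
        then show False using not_both_ports[OF fr, of e] f(3)[OF that(1)] g(2)[OF that(1)] eq \<open>e' = e\<close> that
          by auto
      next
        case False
        then have "covers (f e) (real_point (port e False))" using g(2)[OF that(1)] eq \<open>e' = e\<close> by simp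
        then show False using f(1,2)[OF that(1)] False unfolding served_def by blast
      qed
    qed
  qed
  then have disj: "g ` ?A \<subseteq> T - f ` ?A" using g(1) by blast
  have same: "endpoint e (served T e) = endpoint e' (served T e')"
    if "e \<in> ?A" "e' \<in> ?A" "g e = g e'" for e e'
  proof (cases "e = e'")
    case False
    have "covers (g e) (real_point (port e' (served T e')))" using g(2)[OF that(2)] that(3) by simp
    then show ?thesis
      using that(1,2) by (intro ports_same_endpoint[OF free[OF g(1)[OF that(1)]] _ _ False g(2)[OF that(1)]]) simp_all
  qed simp
  \<comment> \<open>\<open>h\<close> reads the selected vertex off a box; by \<open>same\<close> the
    choice does not depend on the edge. So there are at most as many selected vertices as boxes in
    the image of \<open>g\<close>.\<close>
  define h where "h X = (SOME v. \<exists>e\<in>?A. g e = X \<and> v = endpoint e (served T e))" for X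
  have "h (g e) = endpoint e (served T e)" if "e \<in> ?A" for e
    unfolding h_def
  proof (rule some_equality)
    show "\<exists>e'\<in>?A. g e' = g e \<and> endpoint e (served T e) = endpoint e' (served T e')"
      using that by blast
  next
    fix v assume "\<exists>e'\<in>?A. g e' = g e \<and> v = endpoint e' (served T e')"
    then show "v = endpoint e (served T e)" using same[OF _ that] by blast
  qed
  then have "chosen T = h ` g ` ?A" unfolding chosen_def image_image by (intro image_cong) simp_all
  then have "card (chosen T) \<le> card (g ` ?A)" by (simp add: card_image_le)
  also have "\<dots> \<le> card (T - f ` ?A)" using disj fin by (intro card_mono) auto
  also have "\<dots> = card T - length es"
    using f(1) fin card_image[OF inj] by (subst card_Diff_subset) auto
  finally have "card (chosen T) \<le> card T - length es" .
  \<comment> \<open>Subtraction of natural numbers is truncated, so the bound just obtained needs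
    this to be turned into a sum.\<close>
  moreover have "length es \<le> card T"
    using card_mono[OF fin, of "f ` ?A"] f(1) card_image[OF inj] by auto
  ultimately show ?thesis by linarith
qed

text \<open>A strip along the row of each vertex of \<open>C\<close> takes all ports of that vertex.
  The box of an edge takes its centre and the port that may be missing: the second one if the first
  endpoint lies in \<open>C\<close>, otherwise the first, and then the second endpoint lies in
  \<open>C\<close>.\<close>

lemma class_cover_exists:
  assumes "finite C" and C: "\<And>e. e < length es \<Longrightarrow> \<exists>q. endpoint e q \<in> C"
  shows "\<exists>T. class_cover (point_sets es) T \<and> card T \<le> card C + length es"
proof -
  define strip where "strip c = int_box 0 (5 * int (length es)) (4 * int c) (4 * int c)" for c
  define ebox where "ebox e = (let a = 4 * int (endpoint e False); b = 4 * int (endpoint e True) in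
     if endpoint e False \<in> C then int_box (5 * int e + 1) (5 * int e + 2) (min (a + 2) b) (max (a + 2) b)
     else int_box (5 * int e) (5 * int e + 1) a (a + 2))" for e
  let ?T = "strip ` C \<union> ebox ` {..<length es}"
  have box: "is_box X" if "X \<in> ?T" for X
    using that by (auto simp: strip_def ebox_def Let_def intro!: is_box_int_box)
  have strip: "covers (strip (endpoint e q)) (real_point (port e q))" if "e < length es" for e q
    using that unfolding strip_def port_def covers_int_box by (cases q) simp_all
  have red: "\<exists>X\<in>?T. covers X r" if r: "r \<in> fst (point_sets es)" for r
  proof -
    from r obtain e where e: "e < length es"
      "r \<in> {real_point (port e False), real_point (centre e), real_point (port e True)}"
      unfolding reds by auto
    have mem: "ebox e \<in> ?T" using e(1) by blast
    have centre: "covers (ebox e) (real_point (centre e))"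
      unfolding ebox_def Let_def centre_def by (simp add: covers_int_box)
    have port: "\<exists>X\<in>?T. covers X (real_point (port e q))" for q
    proof (cases "endpoint e q \<in> C")
      case True
      then show ?thesis using strip[OF e(1)] by blast
    next
      case False
      have "covers (ebox e) (real_point (port e q))"
      proof (cases q)
        case True
        then have "endpoint e False \<in> C" using False C[OF e(1)] by (metis (full_types))
        then show ?thesis using True by (simp add: ebox_def Let_def port_def covers_int_box)
      next
        case q: False
        then show ?thesis using False by (simp add: ebox_def Let_def port_def covers_int_box)
      qed
      then show ?thesis using mem by blast
    qed
    show ?thesis using e(2) port centre mem by auto
  qed
  have blue: "\<not> covers X b" if X: "X \<in> ?T" and b: "b \<in> snd (point_sets es)" for X b
  proof
    assume cov: "covers X b"
    from b obtain e x q y where shape: "(x, q, y) \<in> set blue_shapes"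
      and e: "b = real_point (5 * int e + x, 4 * int (endpoint e q) + y)"
      unfolding point_sets_def set_points shape_point_def endpoint_def by force
    from shape have xy: "x = -1 \<or> x = 3 \<or> x = 0 \<and> \<not> q \<and> (y = 3 \<or> y = -1)"
      and y: "y = 1 \<or> y = 2 \<or> y = 3 \<or> y = -1" by (auto simp: blue_shapes_def)
    from X consider c where "X = strip c" | e' where "X = ebox e'" by blast
    then show False
    proof cases
      case 1
      then have "4 * int (endpoint e q) + y = 4 * int c"
        using cov e by (simp add: strip_def covers_int_box)
      \<comment> \<open>No blue point lies in a row divisible by 4.\<close>
      then show False using y by presburger
    next
      case 2
      then have *: "(5 * int e' + 1 \<le> 5 * int e + x \<and> 5 * int e + x \<le> 5 * int e' + 2) \<or>
        5 * int e' \<le> 5 * int e + x \<and> 5 * int e + x \<le> 5 * int e' + 1 \<and>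
          4 * int (endpoint e' False) \<le> 4 * int (endpoint e q) + y \<and>
          4 * int (endpoint e q) + y \<le> 4 * int (endpoint e' False) + 2"
        using cov e by (auto simp: ebox_def Let_def covers_int_box split: if_splits)
      then have "5 * int e' \<le> 5 * int e + x" "5 * int e + x \<le> 5 * int e' + 2" by linarith+
      moreover have "x = -1 \<or> x = 3 \<or> x = 0" using xy by blast
      \<comment> \<open>Blue columns are 0, 3 or 4 modulo 5, so only column 0 of the same edge
        remains. Its blue points lie just outside the rows of the box that starts in this
        column.\<close>
      ultimately have "x = 0 \<and> e = e'" by presburger
      then show False using * xy by auto
    qed
  qed
  obtain R B where RB: "point_sets es = (R, B)" by fastforce
  have "class_cover (point_sets es) ?T"
    using box red blue assms(1) unfolding class_cover_def RB by auto
  moreover have "card ?T \<le> card C + length es"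
    using card_Un_le[of "strip ` C" "ebox ` {..<length es}"] card_image_le[OF assms(1), of strip]
      card_image_le[of "{..<length es}" ebox] by simp
  ultimately show ?thesis by blast
qed

lemma point_sets_instance: "point_sets es \<in> instances BCC"
proof -
  \<comment> \<open>Every blue point has column 3 or 4 modulo 5 or row 3 modulo 4, and no red point
    does.\<close>
  have *: "shape_point e (es ! e) s \<noteq> shape_point e' (es ! e') s'"
    if "s \<in> set red_shapes" "s' \<in> set blue_shapes" for e e' s s'
    using that by (auto simp: red_shapes_def blue_shapes_def shape_point_def; presburger)
  have "set (points red_shapes es k) \<inter> set (points blue_shapes es k) = {}" for k
    unfolding set_points using * by blast
  then show ?thesis
    unfolding BCC_def point_sets_def by (simp add: image_Int[OF inj_real_point, symmetric])
qed

lemma distinct_red_points: "distinct (points red_shapes es (length es))"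
  using loopless by (intro distinct_points) (auto simp: red_shapes_def shape_point_def)

text \<open>For a loop, the points one row above the two endpoints would coincide.\<close>

lemma distinct_blue_points: "distinct (points blue_shapes es (length es))"
proof (rule distinct_points)
  fix e assume "e < length es"
  from loopless[OF this] show "distinct (map (shape_point e (es ! e)) blue_shapes)"
    by (simp add: blue_shapes_def shape_point_def)
qed (auto simp: blue_shapes_def)

end

section \<open>The reduction as a program\<close>

definition vertex_val :: "nat \<Rightarrow> val" where
  "vertex_val u = Num (int u)"

definition edge_val :: "nat \<times> nat \<Rightarrow> val" where
  "edge_val uw = Cell (vertex_val (fst uw)) (vertex_val (snd uw))"

definition point_val :: "int \<times> int \<Rightarrow> val" where
  "point_val z = Cell (Cell (Num (fst z)) (Num 1)) (Cell (Num (snd z)) (Num 1))"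

text \<open>Every variable other than 0 lies above those of the given program.  The variable \<open>N\<close> keeps
  the edge list, \<open>N + 1\<close> its unprocessed part and \<open>N + 2\<close> the column \<open>5 e\<close> of the current edge
  \<open>e\<close>.\<close>

definition shape_expr :: "nat \<Rightarrow> int \<times> bool \<times> int \<Rightarrow> expr" where
  "shape_expr N = (\<lambda>(x, q, y).
    MkCell (MkCell (Plus (Var (N + 2)) (Const x)) (Const 1))
      (MkCell (Plus (Times (Const 4) ((if q then Snd else Fst) (Fst (Var (N + 1))))) (Const y)) (Const 1)))"

definition shapes_expr :: "nat \<Rightarrow> (int \<times> bool \<times> int) list \<Rightarrow> expr \<Rightarrow> expr" where
  "shapes_expr N shapes e = foldr (\<lambda>s. MkCell (shape_expr N s)) shapes e"

lemma eval_shapes_expr: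
  assumes "s (N + 2) = Num (5 * int k)" "s (N + 1) = Cell (edge_val uw) r"
    "eval e s = val_list (map point_val zs)"
  shows "eval (shapes_expr N shapes e) s = val_list (map point_val (map (shape_point k uw) shapes @ zs))"
proof -
  have "eval (shape_expr N p) s = point_val (shape_point k uw p)" for p
    using assms(1,2) by (cases p) (simp add: shape_expr_def shape_point_def point_val_def edge_val_def vertex_val_def)
  then show ?thesis using assms(3) by (induction shapes) (simp_all add: shapes_expr_def)
qed

definition encode_body :: "nat \<Rightarrow> com" where
  "encode_body N =
    Seq (Assign (N + 3) (shapes_expr N red_shapes (Var (N + 3))))
    (Seq (Assign (N + 4) (shapes_expr N blue_shapes (Var (N + 4))))
    (Seq (Assign (N + 2) (Plus (Var (N + 2)) (Const 5)))
      (Assign (N + 1) (Snd (Var (N + 1))))))"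

definition encode_start :: "nat \<Rightarrow> com" where
  "encode_start N = Seq (Assign N (Snd (Var 0))) (Assign (N + 1) (Snd (Var 0)))"

definition encode_end :: "nat \<Rightarrow> com" where
  "encode_end N = Assign 0 (MkCell (Var (N + 3)) (Var (N + 4)))"

definition encode :: "nat \<Rightarrow> com" where
  "encode N = Seq (encode_start N) (Seq (While (Var (N + 1)) (encode_body N)) (encode_end N))"

text \<open>At most \<open>n\<close> edges with at most 8 points of one colour each, every point of
  size at most \<open>20 + 6 * n\<close> plus one for its list node. The summand
  \<open>2 + 6 * n\<close> leaves room for the input and the column counter.\<close>

definition size_bound :: "nat \<Rightarrow> nat" where
  "size_bound n = 2 + 6 * n + 8 * n * (21 + 6 * n)"

lemma size_bound_ge: "1 \<le> size_bound n" "n \<le> size_bound n"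
  by (simp_all add: size_bound_def)

lemma edge_val_size:
  assumes "uw \<in> set es" "val_size (val_list (map edge_val es)) \<le> n"
  shows "val_size (vertex_val (fst uw)) \<le> n" "val_size (vertex_val (snd uw)) \<le> n"
proof -
  have "val_size (edge_val uw) \<le> n"
    using val_size_member[of "edge_val uw" "map edge_val es"] assms by fastforce
  then show "val_size (vertex_val (fst uw)) \<le> n" "val_size (vertex_val (snd uw)) \<le> n"
    by (simp_all add: edge_val_def)
qed

text \<open>Columns grow with the number of edges and can be bounded by their value. A vertex label
  may be exponential in \<open>n\<close>, so its row is bounded through bit sizes.\<close>

lemma val_size_points:
  assumes n: "val_size (val_list (map edge_val es)) \<le> n" and k: "k \<le> length es"
    and shapes: "length shapes \<le> 8"
      "\<And>x q y. (x, q, y) \<in> set shapes \<Longrightarrow> \<bar>x\<bar> \<le> 3 \<and> \<bar>y\<bar> \<le> 3"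
  shows "val_size (val_list (map point_val (points shapes es k))) \<le> size_bound n"
proof -
  have len: "length es \<le> n" using length_le_val_size[of "map edge_val es"] n by simp
  have "val_size v \<le> 20 + 6 * n" if "v \<in> set (map point_val (points shapes es k))" for v
  proof -
    from that obtain e x q y where v: "v = point_val (shape_point e (es ! e) (x, q, y))"
      and e: "e < k" and xy: "(x, q, y) \<in> set shapes"
      by (auto simp: set_points)
    let ?u = "if q then snd (es ! e) else fst (es ! e)"
    have "val_size (Num (5 * int e + x)) \<le> 4 + 5 * n"
      using val_size_Num_le[of "5 * int e + x"] shapes(2)[OF xy] e k len by linarith
    moreover have "val_size (Num (int ?u)) \<le> n"
      using edge_val_size[OF nth_mem[of e es] n] e k by (simp add: vertex_val_def)
    then have "val_size (Num (4 * int ?u + y)) \<le> 9 + n"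
      using val_size_add[of "4 * int ?u" y] val_size_mult[of 4 "int ?u"]
        val_size_Num_le[of 4] val_size_Num_le[of y] shapes(2)[OF xy] by linarith
    moreover have "val_size (Num 1) \<le> 2" using val_size_Num_le[of 1] by simp
    ultimately show ?thesis
      unfolding v point_val_def shape_point_def by (simp del: val_size.simps(1))
  qed
  then have "val_size (val_list (map point_val (points shapes es k))) \<le>
      1 + length (map point_val (points shapes es k)) * (1 + (20 + 6 * n))"
    by (rule val_size_val_list_le)
  then have "val_size (val_list (map point_val (points shapes es k))) \<le> 1 + k * length shapes * (21 + 6 * n)"
    by (simp add: length_points)
  also have "k * length shapes * (21 + 6 * n) \<le> n * 8 * (21 + 6 * n)"
    using k len shapes(1) by (intro mult_le_mono1 mult_le_mono) auto
  finally show ?thesis by (simp add: size_bound_def mult.commute[of n 8])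
qed

lemma shapes_bounds:
  "length red_shapes \<le> 8" "(x, q, y) \<in> set red_shapes \<Longrightarrow> \<bar>x\<bar> \<le> 3 \<and> \<bar>y\<bar> \<le> 3"
  "length blue_shapes \<le> 8" "(x, q, y) \<in> set blue_shapes \<Longrightarrow> \<bar>x\<bar> \<le> 3 \<and> \<bar>y\<bar> \<le> 3"
  by (auto simp: red_shapes_def blue_shapes_def)

definition encode_cost :: "nat \<Rightarrow> nat \<Rightarrow> nat" where
  "encode_cost N n = 1 + com_weight (encode_start N) * size_bound n +
    (1 + (n + 1) * (1 + n + com_weight (encode_body N) * size_bound n) +
      com_weight (encode_end N) * size_bound n)"

text \<open>Besides the point set, the postcondition keeps what comes next: zeros below
  \<open>N\<close>, so that the given program finds its initial state; the edge list for the
  decoder; and \<open>Num 0\<close> in \<open>N + 5\<close>, the empty list of vertices.\<close>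

lemma runs_encode:
  assumes "0 < N" and v: "v = Cell a (val_list (map edge_val es))"
  shows "runs (encode N) (init_state v) (encode_cost N (val_size v)) (\<lambda>s.
    s 0 = Cell (val_list (map point_val (points red_shapes es (length es))))
      (val_list (map point_val (points blue_shapes es (length es)))) \<and>
    s N = val_list (map edge_val es) \<and> s (N + 5) = Num 0 \<and>
    (\<forall>y. 0 < y \<and> y < N \<longrightarrow> s y = Num 0) \<and> (\<forall>y>N. val_size (s y) \<le> size_bound (val_size v)))"
proof -
  define n where "n = val_size v"
  let ?vs = "map edge_val es"
  have n: "val_size (val_list ?vs) \<le> n" by (simp add: n_def v)
  have len: "length es \<le> n" using length_le_val_size[of ?vs] n by simp
  have size0: "val_size (Num 0) = 1" by (simp add: floorlog_def)
  define Inv where "Inv k s \<longleftrightarrow> s 0 = v \<and> s N = val_list ?vs \<and> s (N + 1) = val_list (drop k ?vs) \<and>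
    s (N + 2) = Num (5 * int k) \<and>
    s (N + 3) = val_list (map point_val (points red_shapes es k)) \<and>
    s (N + 4) = val_list (map point_val (points blue_shapes es k)) \<and>
    (\<forall>y. y \<notin> {0, N, N + 1, N + 2, N + 3, N + 4} \<longrightarrow> s y = Num 0)" for k and s :: state
  have size: "val_size (s y) \<le> size_bound n" if "Inv k s" "k \<le> length es" for k s y
  proof -
    have "val_size (Num (5 * int k)) \<le> size_bound n"
      using val_size_Num_le[of "5 * int k"] len that(2) by (simp add: size_bound_def)
    moreover have "val_size (val_list (drop k ?vs)) \<le> size_bound n" "val_size (val_list ?vs) \<le> size_bound n"
      using val_size_val_list_drop[of k ?vs] n size_bound_ge(2)[of n] by linarith+
    moreover have "val_size (s y) \<le> size_bound n" if "y \<notin> {0, N, N + 1, N + 2, N + 3, N + 4}"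
      using that \<open>Inv k s\<close> size0 size_bound_ge(1)[of n] by (simp add: Inv_def)
    moreover have "val_size (s 0) \<le> size_bound n"
      using \<open>Inv k s\<close> size_bound_ge(2)[of n] by (simp add: Inv_def n_def)
    moreover have "val_size (val_list (map point_val (points red_shapes es k))) \<le> size_bound n"
      by (rule val_size_points[OF n that(2) shapes_bounds(1)]) (rule shapes_bounds(2))
    moreover have "val_size (val_list (map point_val (points blue_shapes es k))) \<le> size_bound n"
      by (rule val_size_points[OF n that(2) shapes_bounds(3)]) (rule shapes_bounds(4))
    moreover have "y \<in> {0, N, N + 1, N + 2, N + 3, N + 4} \<or> y \<notin> {0, N, N + 1, N + 2, N + 3, N + 4}"
      by blast
    ultimately show ?thesis using \<open>Inv k s\<close> unfolding Inv_def insert_iff empty_iff by metis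
  qed
  have start: "runs (encode_start N) (init_state v) (com_weight (encode_start N) * size_bound n) (Inv 0)"
  proof (rule runs_loop_free)
    show "\<forall>x\<in>com_vars (encode_start N). val_size (init_state v x) \<le> size_bound n"
      using size_bound_ge[of n] by (simp add: init_state_def n_def floorlog_def encode_start_def)
    show "Inv 0 (result (encode_start N) (init_state v))"
      using \<open>0 < N\<close> by (auto simp: Inv_def encode_start_def init_state_def v points_simps)
  qed (auto simp: encode_start_def size_bound_def)
  have step: "runs (encode_body N) s (com_weight (encode_body N) * size_bound n) (Inv (Suc k))"
    if k: "k < length ?vs" and inv: "Inv k s" for k s
  proof (rule runs_loop_free)
    show "loop_free (encode_body N)" by (simp add: encode_body_def)
    show "\<forall>x\<in>com_vars (encode_body N). val_size (s x) \<le> size_bound n"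
      using size[OF inv] k by simp
    let ?s = "s(N + 3 := val_list (map point_val (points red_shapes es (Suc k))))"
    have L: "s (N + 1) = Cell (edge_val (es ! k)) (val_list (drop (Suc k) ?vs))"
      using inv k unfolding Inv_def by (simp flip: Cons_nth_drop_Suc)
    have "eval (shapes_expr N red_shapes (Var (N + 3))) s =
        val_list (map point_val (points red_shapes es (Suc k)))"
      unfolding points_simps using inv L by (intro eval_shapes_expr) (auto simp: Inv_def)
    moreover have "eval (shapes_expr N blue_shapes (Var (N + 4))) ?s =
        val_list (map point_val (points blue_shapes es (Suc k)))"
      unfolding points_simps(2)[of blue_shapes] using inv L by (intro eval_shapes_expr) (auto simp: Inv_def)
    ultimately have "result (encode_body N) s = ?s(N + 4 := val_list (map point_val (points blue_shapes es (Suc k))),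
        N + 2 := Num (5 * int (Suc k)), N + 1 := val_list (drop (Suc k) ?vs))"
      using inv L by (simp add: encode_body_def Inv_def add.commute)
    then show "Inv (Suc k) (result (encode_body N) s)" using inv \<open>0 < N\<close> unfolding Inv_def by auto
  qed (rule size_bound_ge)
  have loop: "runs (While (Var (N + 1)) (encode_body N)) s
      ((n + 1) * (1 + n + com_weight (encode_body N) * size_bound n)) (Inv (length es))"
    if "Inv 0 s" for s
  proof (rule runs_mono)
    show "runs (While (Var (N + 1)) (encode_body N)) s
        ((length ?vs + 1) * (1 + n + com_weight (encode_body N) * size_bound n)) (Inv (length ?vs))"
      by (rule runs_While_list[OF _ step n that]) (simp add: Inv_def)
    show "(length ?vs + 1) * (1 + n + com_weight (encode_body N) * size_bound n) \<le>
        (n + 1) * (1 + n + com_weight (encode_body N) * size_bound n)"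
      using len by (intro mult_le_mono1) simp
  qed simp
  have fin: "runs (encode_end N) s (com_weight (encode_end N) * size_bound n) (\<lambda>s.
    s 0 = Cell (val_list (map point_val (points red_shapes es (length es))))
      (val_list (map point_val (points blue_shapes es (length es)))) \<and>
    s N = val_list (map edge_val es) \<and> s (N + 5) = Num 0 \<and>
    (\<forall>y. 0 < y \<and> y < N \<longrightarrow> s y = Num 0) \<and> (\<forall>y>N. val_size (s y) \<le> size_bound n))"
    if inv: "Inv (length es) s" for s
    using size[OF inv] inv \<open>0 < N\<close> size_bound_ge
    by (intro runs_loop_free) (auto simp: encode_end_def Inv_def)
  show ?thesis
    unfolding encode_def encode_cost_def n_def[symmetric]
    by (intro runs_Seq runs_mono[OF start] order.refl runs_mono[OF loop] runs_mono[OF fin]) simp_all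
qed

section \<open>The decoder: selecting vertices from boxes\<close>

definition box_serves :: "val \<Rightarrow> int \<Rightarrow> int \<Rightarrow> bool" where
  "box_serves b x y \<longleftrightarrow>
    val_int (val_fst (val_fst (val_fst b))) < x * val_int (val_snd (val_fst (val_fst b))) \<and>
    (x + 1) * val_int (val_snd (val_fst (val_snd b))) < val_int (val_fst (val_fst (val_snd b))) \<and>
    val_int (val_fst (val_snd (val_fst b))) < y * val_int (val_snd (val_snd (val_fst b))) \<and>
    (y + 2) * val_int (val_snd (val_snd (val_snd b))) < val_int (val_fst (val_snd (val_snd b)))"

text \<open>Multiplying by the positive denominators leaves integer comparisons. Four of them
  suffice for two points: the centre lies to the right of and above the first port, so the lower
  left corner is compared with the port and the upper right one with the centre.\<close>

lemma box_serves_iff: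
  assumes "codes_box X b"
  shows "box_serves b x y \<longleftrightarrow>
    covers X (real_point (x + 1, y + 2)) \<and> covers X (real_point (x, y))"
proof -
  from assms obtain p q a1 b1 a2 b2 a3 b3 a4 b4 where X: "X = cbox p q"
    and b: "b = Cell (Cell (Cell (Num a1) (Num b1)) (Cell (Num a2) (Num b2)))
      (Cell (Cell (Num a3) (Num b3)) (Cell (Num a4) (Num b4)))"
    and pq: "b1 > 0" "b2 > 0" "b3 > 0" "b4 > 0"
      "fst p = of_int a1 / of_int b1" "snd p = of_int a2 / of_int b2"
      "fst q = of_int a3 / of_int b3" "snd q = of_int a4 / of_int b4"
    unfolding codes_box_def codes_point_def codes_real_def by blast
  have less: "of_int c / of_int d < (of_int z :: real) \<longleftrightarrow> c < z * d"
    and greater: "of_int z < (of_int c / of_int d :: real) \<longleftrightarrow> z * d < c" if "d > 0" for c d z :: int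
    using that by (simp_all add: divide_less_eq less_divide_eq flip: of_int_mult)
  show ?thesis
    unfolding X covers_cbox real_point_Pair fst_conv snd_conv pq(5-8)
      less[OF pq(1)] less[OF pq(2)] greater[OF pq(3)] greater[OF pq(4)] box_serves_def b
      val_fst.simps val_snd.simps val_int.simps
    using pq(1-4) mult_strict_right_mono[of x "x + 1" b1] mult_strict_right_mono[of x "x + 1" b3]
      mult_strict_right_mono[of y "y + 2" b2] mult_strict_right_mono[of y "y + 2" b4] by linarith
qed

text \<open>Truth values are 0 and 1, so products express the conjunction.\<close>

definition serves_expr :: "nat \<Rightarrow> expr" where
  "serves_expr N = (let b = Fst (Var (N + 6)); x = Var (N + 2); y = Times (Const 4) (Fst (Fst (Var (N + 1)))) in
    Times
      (Times (Less (Fst (Fst (Fst b))) (Times x (Snd (Fst (Fst b)))))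
        (Less (Times (Plus x (Const 1)) (Snd (Fst (Snd b)))) (Fst (Fst (Snd b)))))
      (Times (Less (Fst (Snd (Fst b))) (Times y (Snd (Snd (Fst b)))))
        (Less (Times (Plus y (Const 2)) (Snd (Snd (Snd b)))) (Fst (Snd (Snd b))))))"

lemma eval_serves_expr:
  assumes "s (N + 6) = Cell b r" "s (N + 2) = Num x" "s (N + 1) = Cell (edge_val uw) r'"
  shows "eval (serves_expr N) s = Num 0 \<longleftrightarrow> \<not> box_serves b x (4 * int (fst uw))"
  using assms by (auto simp: serves_expr_def Let_def val_bool_def box_serves_def edge_val_def vertex_val_def)

text \<open>In the decoder, \<open>N + 5\<close> collects the vertices, \<open>N + 6\<close> holds
  the boxes still to be tested, \<open>N + 7\<close> the vertex selected for the current edge,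
  \<open>N + 8\<close> the part of the collected list still to be searched, and \<open>N + 9\<close>
  tells whether the vertex was found there.\<close>

definition scan_body :: "nat \<Rightarrow> com" where
  "scan_body N =
    Seq (Cond (serves_expr N) (Assign (N + 7) (Snd (Fst (Var (N + 1))))) Skip)
      (Assign (N + 6) (Snd (Var (N + 6))))"

lemma val_bool_eq_0: "val_bool P = Num 0 \<longleftrightarrow> \<not> P"
  by (simp add: val_bool_def)

text \<open>Several edges may select the same vertex, but the encoding of a solution must list it
  once.\<close>

definition search_body :: "nat \<Rightarrow> com" where
  "search_body N =
    Seq (Cond (Equal (Fst (Var (N + 8))) (Var (N + 7))) (Assign (N + 9) (Const 1)) Skip)
      (Assign (N + 8) (Snd (Var (N + 8))))"

definition decode_pre :: "nat \<Rightarrow> com" where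
  "decode_pre N = Seq (Assign (N + 6) (Var 0)) (Seq (Assign (N + 7) (Fst (Fst (Var (N + 1)))))
    (Seq (Assign (N + 8) (Var (N + 5))) (Assign (N + 9) (Const 0))))"

definition decode_post :: "nat \<Rightarrow> com" where
  "decode_post N =
    Seq (Cond (Var (N + 9)) Skip (Assign (N + 5) (MkCell (Var (N + 7)) (Var (N + 5)))))
    (Seq (Assign (N + 2) (Plus (Var (N + 2)) (Const 5))) (Assign (N + 1) (Snd (Var (N + 1)))))"

definition decode_body :: "nat \<Rightarrow> com" where
  "decode_body N = Seq (decode_pre N) (Seq (While (Var (N + 6)) (scan_body N))
    (Seq (While (Var (N + 8)) (search_body N)) (decode_post N)))"

definition decode_start :: "nat \<Rightarrow> com" where
  "decode_start N = Seq (Assign (N + 1) (Var N)) (Assign (N + 2) (Const 0))"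

definition decode_end :: "nat \<Rightarrow> com" where
  "decode_end N = Assign 0 (Var (N + 5))"

definition decode :: "nat \<Rightarrow> com" where
  "decode N = Seq (decode_start N) (Seq (While (Var (N + 1)) (decode_body N)) (decode_end N))"

lemma runs_scan:
  assumes s: "s (N + 6) = val_list bs" "s (N + 7) = vertex_val (fst uw)"
    "s (N + 1) = Cell (edge_val uw) r" "s (N + 2) = Num x"
    and M: "val_size (val_list bs) \<le> M" "\<And>y. N < y \<Longrightarrow> val_size (s y) \<le> M" "length bs \<le> W"
  shows "runs (While (Var (N + 6)) (scan_body N)) s ((W + 1) * (1 + M + com_weight (scan_body N) * M))
    (\<lambda>s'. s' (N + 6) = Num 0 \<and> (\<forall>y. y \<notin> {N + 6, N + 7} \<longrightarrow> s' y = s y) \<and>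
      s' (N + 7) = vertex_val
        (if \<exists>b\<in>set bs. box_serves b x (4 * int (fst uw)) then snd uw else fst uw))"
proof -
  define Inv where "Inv j s' \<longleftrightarrow> s' (N + 6) = val_list (drop j bs) \<and>
    (\<forall>y. y \<notin> {N + 6, N + 7} \<longrightarrow> s' y = s y) \<and>
    s' (N + 7) = vertex_val
      (if \<exists>b\<in>set (take j bs). box_serves b x (4 * int (fst uw)) then snd uw else fst uw)" for j and s' :: state
  have "val_size (edge_val uw) < M" using M(2)[of "N + 1"] s(3) by simp
  then have uw: "val_size (vertex_val (fst uw)) \<le> M" "val_size (vertex_val (snd uw)) \<le> M"
    by (simp_all add: edge_val_def)
  have "runs (While (Var (N + 6)) (scan_body N)) s ((length bs + 1) * (1 + M + com_weight (scan_body N) * M))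
    (Inv (length bs))"
  proof (rule runs_While_list)
    fix j s' assume j: "j < length bs" and inv: "Inv j s'"
    show "runs (scan_body N) s' (com_weight (scan_body N) * M) (Inv (Suc j))"
    proof (rule runs_loop_free)
      have "val_size (s' y) \<le> M" if "N < y" for y
        using inv M(2)[OF that] uw val_size_val_list_drop[of j bs] M(1) unfolding Inv_def
        by (cases "y = N + 6"; cases "y = N + 7") auto
      then show "\<forall>y\<in>com_vars (scan_body N). val_size (s' y) \<le> M"
        by (simp add: scan_body_def serves_expr_def Let_def)
      have L: "s' (N + 6) = Cell (bs ! j) (val_list (drop (Suc j) bs))"
        and w: "s' (N + 7) = vertex_val
          (if \<exists>b\<in>set (take j bs). box_serves b x (4 * int (fst uw)) then snd uw else fst uw)"
        and fr: "\<forall>y. y \<notin> {N + 6, N + 7} \<longrightarrow> s' y = s y"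
        using inv j unfolding Inv_def by (simp_all flip: Cons_nth_drop_Suc)
      have L1: "s' (N + 1) = Cell (edge_val uw) r" and x: "s' (N + 2) = Num x" using fr s by simp_all
      have "result (scan_body N) s' = s'(N + 7 := vertex_val
          (if \<exists>b\<in>set (take (Suc j) bs). box_serves b x (4 * int (fst uw)) then snd uw else fst uw),
          N + 6 := val_list (drop (Suc j) bs))"
        using eval_serves_expr[OF L x L1] L w L1 j
        by (intro ext) (auto simp: scan_body_def take_Suc_conv_app_nth edge_val_def)
      then show "Inv (Suc j) (result (scan_body N) s')" using fr by (simp add: Inv_def)
    qed (use uw val_size_pos[of "vertex_val (fst uw)"] in \<open>auto simp: scan_body_def\<close>)
  qed (use s M(1) in \<open>auto simp: Inv_def\<close>)
  then show ?thesis
  proof (rule runs_mono)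
    show "(length bs + 1) * (1 + M + com_weight (scan_body N) * M) \<le>
      (W + 1) * (1 + M + com_weight (scan_body N) * M)" using M(3) by (intro mult_le_mono1) simp
  qed (simp add: Inv_def)
qed

lemma runs_search:
  assumes s: "s (N + 8) = val_list (map vertex_val cs)" "s (N + 7) = vertex_val w" "s (N + 9) = Num 0"
    and M: "val_size (val_list (map vertex_val cs)) \<le> M" "\<And>y. N < y \<Longrightarrow> val_size (s y) \<le> M"
      "2 \<le> M" "length cs \<le> W"
  shows "runs (While (Var (N + 8)) (search_body N)) s ((W + 1) * (1 + M + com_weight (search_body N) * M))
    (\<lambda>s'. s' (N + 8) = Num 0 \<and> (\<forall>y. y \<notin> {N + 8, N + 9} \<longrightarrow> s' y = s y) \<and>
      s' (N + 9) = val_bool (w \<in> set cs))"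
proof -
  let ?vs = "map vertex_val cs"
  define Inv where "Inv j s' \<longleftrightarrow> s' (N + 8) = val_list (drop j ?vs) \<and>
    (\<forall>y. y \<notin> {N + 8, N + 9} \<longrightarrow> s' y = s y) \<and>
    s' (N + 9) = val_bool (w \<in> set (take j cs))" for j and s' :: state
  have "runs (While (Var (N + 8)) (search_body N)) s ((length ?vs + 1) * (1 + M + com_weight (search_body N) * M))
    (Inv (length ?vs))"
  proof (rule runs_While_list)
    fix j s' assume j: "j < length ?vs" and inv: "Inv j s'"
    show "runs (search_body N) s' (com_weight (search_body N) * M) (Inv (Suc j))"
    proof (rule runs_loop_free)
      have "val_size (s' y) \<le> M" if "N < y" for y
        using inv M(2)[OF that] val_size_val_list_drop[of j ?vs] M(1,3)
          val_size_bool[of "w \<in> set (take j cs)"] unfolding Inv_def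
        by (cases "y = N + 8"; cases "y = N + 9") auto
      then show "\<forall>y\<in>com_vars (search_body N). val_size (s' y) \<le> M"
        by (simp add: search_body_def)
      have "s' (N + 8) = Cell (vertex_val (cs ! j)) (val_list (drop (Suc j) ?vs))"
        and f: "s' (N + 9) = val_bool (w \<in> set (take j cs))"
        and fr: "\<forall>y. y \<notin> {N + 8, N + 9} \<longrightarrow> s' y = s y"
        using inv j unfolding Inv_def by (simp_all flip: Cons_nth_drop_Suc)
      moreover have "s' (N + 7) = vertex_val w" using fr s(2) by simp
      ultimately have "result (search_body N) s' = s'(N + 9 := val_bool (w \<in> set (take (Suc j) cs)),
          N + 8 := val_list (drop (Suc j) ?vs))"
        using j
        by (intro ext) (auto simp: search_body_def take_Suc_conv_app_nth vertex_val_def val_bool_def)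
      then show "Inv (Suc j) (result (search_body N) s')" using fr by (simp add: Inv_def)
    qed (use M(3) in \<open>auto simp: search_body_def\<close>)
  qed (use s M(1) in \<open>auto simp: Inv_def val_bool_def\<close>)
  then show ?thesis
  proof (rule runs_mono)
    show "(length ?vs + 1) * (1 + M + com_weight (search_body N) * M) \<le>
      (W + 1) * (1 + M + com_weight (search_body N) * M)" using M(4) by (intro mult_le_mono1) simp
  qed (simp add: Inv_def)
qed

definition decode_step_cost :: "nat \<Rightarrow> nat \<Rightarrow> nat \<Rightarrow> nat" where
  "decode_step_cost N n M = 1 + com_weight (decode_pre N) * M +
    (1 + (M + 1) * (1 + M + com_weight (scan_body N) * M) +
      (1 + (n + 1) * (1 + M + com_weight (search_body N) * M) + com_weight (decode_post N) * M))"

definition decode_cost :: "nat \<Rightarrow> nat \<Rightarrow> nat \<Rightarrow> nat" where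
  "decode_cost N n M = 1 + com_weight (decode_start N) * M +
    (1 + (n + 1) * (1 + M + decode_step_cost N n M) + com_weight (decode_end N) * M)"

text \<open>The computable form of \<open>endpoint k (served T k)\<close>, expressed through encoded
  boxes.\<close>

definition selected :: "val list \<Rightarrow> (nat \<times> nat) list \<Rightarrow> nat \<Rightarrow> nat" where
  "selected bs es k =
    (if \<exists>b\<in>set bs. box_serves b (5 * int k) (4 * int (fst (es ! k))) then snd (es ! k) else fst (es ! k))"

text \<open>Two bounds are kept apart: \<open>n\<close> limits the graph and thus the list of
  vertices, while \<open>M\<close> also limits the list of boxes, which can be as long as the cost
  of the given program permits.\<close>

lemma runs_decode:
  assumes s0: "s0 0 = val_list bs" "s0 N = val_list (map edge_val es)" "s0 (N + 5) = Num 0" and "0 < N"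
    and n: "val_size (val_list (map edge_val es)) \<le> n"
    and M: "val_size (val_list bs) \<le> M" "size_bound n \<le> M" "\<And>y. N < y \<Longrightarrow> val_size (s0 y) \<le> M"
  shows "runs (decode N) s0 (decode_cost N n M) (\<lambda>s. \<exists>cs. distinct cs \<and>
    set cs = selected bs es ` {..<length es} \<and> s 0 = val_list (map vertex_val cs))"
proof -
  let ?vs = "map edge_val es"
  have len: "length es \<le> n" using length_le_val_size[of ?vs] n by simp
  have M2: "2 \<le> M" "n \<le> M" using M(2) by (simp_all add: size_bound_def)
  have lenb: "length bs \<le> M" using length_le_val_size[of bs] M(1) by simp
  define Inv where "Inv k s \<longleftrightarrow> s 0 = val_list bs \<and> s (N + 1) = val_list (drop k ?vs) \<and>
    s (N + 2) = Num (5 * int k) \<and> (\<forall>y>N. val_size (s y) \<le> M) \<and>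
    (\<exists>cs. distinct cs \<and> set cs = selected bs es ` {..<k} \<and> s (N + 5) = val_list (map vertex_val cs))"
    for k and s :: state
  \<comment> \<open>Without repetitions, the list holds at most one vertex per edge
    processed.\<close>
  have size_list: "val_size (val_list (map vertex_val cs)) \<le> size_bound n"
    and len_list: "length cs \<le> n"
    if "distinct cs" "set cs = selected bs es ` {..<k}" "k \<le> length es" for cs k
  proof -
    have "card (set cs) \<le> k" using card_image_le[of "{..<k}" "selected bs es"] that(2) by simp
    then show "length cs \<le> n" using that(1,3) len by (simp add: distinct_card)
    have "val_size c \<le> n" if c: "c \<in> set (map vertex_val cs)" for c
    proof -
      from c obtain e where e: "e < k" "c = vertex_val (selected bs es e)"
        using \<open>set cs = _\<close> by auto
      then show ?thesis
        using edge_val_size[OF nth_mem[of e es] n] \<open>k \<le> length es\<close> by (simp add: selected_def)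
    qed
    then have "val_size (val_list (map vertex_val cs)) \<le> 1 + length (map vertex_val cs) * (1 + n)"
      by (rule val_size_val_list_le)
    also have "\<dots> \<le> 1 + n * (1 + n)" using \<open>length cs \<le> n\<close> by (simp only: length_map add_le_mono le_refl mult_le_mono)
    also have "\<dots> \<le> size_bound n" by (simp add: size_bound_def algebra_simps)
    finally show "val_size (val_list (map vertex_val cs)) \<le> size_bound n" .
  qed
  have size_col: "val_size (Num (5 * int k)) \<le> M" if "k \<le> length es" for k
    using val_size_Num_le[of "5 * int k"] len that M(2) by (simp add: size_bound_def)
  have step: "runs (decode_body N) s (decode_step_cost N n M) (Inv (Suc k))"
    if k: "k < length ?vs" and inv: "Inv k s" for k s
  proof -
    have L: "s (N + 1) = Cell (edge_val (es ! k)) (val_list (drop (Suc k) ?vs))"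
      using inv k unfolding Inv_def by (simp flip: Cons_nth_drop_Suc)
    have col: "s (N + 2) = Num (5 * int k)" using inv by (simp add: Inv_def)
    from inv obtain cs where cs: "distinct cs" "set cs = selected bs es ` {..<k}"
      "s (N + 5) = val_list (map vertex_val cs)" unfolding Inv_def by blast
    have len_cs: "length cs \<le> n" and size_cs: "val_size (val_list (map vertex_val cs)) \<le> M"
      using size_list[OF cs(1,2)] len_list[OF cs(1,2)] k M(2) by auto
    have size: "val_size (s y) \<le> M" if "N < y \<or> y = 0" for y
      using that inv M(1) by (auto simp: Inv_def)
    define s1 where "s1 = result (decode_pre N) s"
    have s1: "s1 (N + 6) = val_list bs" "s1 (N + 7) = vertex_val (fst (es ! k))"
      "s1 (N + 8) = val_list (map vertex_val cs)" "s1 (N + 9) = Num 0"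
      "\<forall>y. y \<notin> {N + 6, N + 7, N + 8, N + 9} \<longrightarrow> s1 y = s y"
      using L cs(3) conjunct1[OF inv[unfolded Inv_def]] by (simp_all add: s1_def decode_pre_def edge_val_def)
    have edge_size: "val_size (vertex_val (fst (es ! k))) \<le> M" "val_size (vertex_val (snd (es ! k))) \<le> M"
      using edge_val_size[OF nth_mem[of k es] n] k M2 by auto
    have size_s1: "val_size (s1 y) \<le> M" if "N < y" for y
    proof -
      consider "y = N + 6" | "y = N + 7" | "y = N + 8" | "y = N + 9" | "y \<notin> {N + 6, N + 7, N + 8, N + 9}"
        by blast
      then show ?thesis
        by cases (use s1 size that M edge_size size_cs M2 in \<open>auto simp: floorlog_def\<close>)
    qed
    have pre: "runs (decode_pre N) s (com_weight (decode_pre N) * M) (\<lambda>s'. s' = s1)"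
      using size M2 by (intro runs_loop_free) (auto simp: decode_pre_def s1_def)
    have scan: "runs (While (Var (N + 6)) (scan_body N)) s1 ((M + 1) * (1 + M + com_weight (scan_body N) * M))
      (\<lambda>s2. (\<forall>y. y \<notin> {N + 6, N + 7} \<longrightarrow> s2 y = s1 y) \<and> s2 (N + 6) = Num 0 \<and>
        s2 (N + 7) = vertex_val (selected bs es k))" (is "runs _ _ _ ?Q2")
      by (rule runs_mono[OF runs_scan[OF s1(1,2) _ _ M(1) size_s1 lenb,
              of "val_list (drop (Suc k) ?vs)" "5 * int k"]])
        (use s1 L inv in \<open>auto simp: selected_def Inv_def\<close>)
    have search: "runs (While (Var (N + 8)) (search_body N)) s2 ((n + 1) * (1 + M + com_weight (search_body N) * M))
      (\<lambda>s3. (\<forall>y. y \<notin> {N + 6, N + 7, N + 8, N + 9} \<longrightarrow> s3 y = s y) \<and> s3 (N + 6) = Num 0 \<and>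
        s3 (N + 7) = vertex_val (selected bs es k) \<and> s3 (N + 8) = Num 0 \<and>
        s3 (N + 9) = val_bool (selected bs es k \<in> set cs))" (is "runs _ _ _ ?Q3") if s2: "?Q2 s2" for s2
    proof -
      have "val_size (s2 y) \<le> M" if "N < y" for y
      proof -
        consider "y = N + 6" | "y = N + 7" | "y \<notin> {N + 6, N + 7}" by blast
        then show ?thesis
          by cases (use s2 size_s1[OF that] edge_size M2 in \<open>auto simp: selected_def floorlog_def\<close>)
      qed
      then show ?thesis
        by (intro runs_mono[OF runs_search[of s2 N cs "selected bs es k" M n]])
          (use s1 s2 size_cs len_cs M2 in auto)
    qed
    have post: "runs (decode_post N) s3 (com_weight (decode_post N) * M) (Inv (Suc k))"
      if s3: "?Q3 s3" for s3
    proof (rule runs_loop_free)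
      have size_s3: "val_size (s3 y) \<le> M" if "N < y" for y
      proof -
        consider "y = N + 6" | "y = N + 7" | "y = N + 8" | "y = N + 9" | "y \<notin> {N + 6, N + 7, N + 8, N + 9}"
          by blast
        then show ?thesis
          by cases (use s3 size that edge_size M2 le_trans[OF val_size_bool M2(1)] in \<open>auto simp: floorlog_def selected_def\<close>)
      qed
      then show "\<forall>y\<in>com_vars (decode_post N). val_size (s3 y) \<le> M" by (simp add: decode_post_def)
      define cs' where "cs' = (if selected bs es k \<in> set cs then cs else selected bs es k # cs)"
      have cs': "distinct cs'" "set cs' = selected bs es ` {..<Suc k}"
        using cs by (auto simp: cs'_def lessThan_Suc)
      have res: "result (decode_post N) s3 =
        s3(N + 5 := val_list (map vertex_val cs'), N + 2 := Num (5 * int (Suc k)), N + 1 := val_list (drop (Suc k) ?vs))"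
        using s3 L cs(3) col by (intro ext) (auto simp: decode_post_def cs'_def val_bool_eq_0)
      have "val_size (val_list (map vertex_val cs')) \<le> M"
        using size_list[OF cs'] k M(2) by simp
      moreover have "val_size (val_list (drop (Suc k) ?vs)) \<le> M"
        using val_size_val_list_drop[of "Suc k" ?vs] n M2(2) by linarith
      ultimately have "\<forall>y>N. val_size (result (decode_post N) s3 y) \<le> M"
        unfolding res using size_s3 size_col[of "Suc k"] k by (auto simp del: val_size.simps)
      moreover have "s3 0 = val_list bs" using s3 inv \<open>0 < N\<close> by (auto simp: Inv_def)
      ultimately show "Inv (Suc k) (result (decode_post N) s3)"
        unfolding Inv_def using cs' \<open>0 < N\<close> by (auto simp: res)
    qed (use M2 in \<open>auto simp: decode_post_def\<close>)
    have "runs (Seq (While (Var (N + 8)) (search_body N)) (decode_post N)) s2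
      (1 + (n + 1) * (1 + M + com_weight (search_body N) * M) + com_weight (decode_post N) * M)
      (Inv (Suc k))" if "?Q2 s2" for s2
      by (rule runs_Seq[OF runs_mono[OF search[OF that] le_refl post]])
    note runs_Seq[OF runs_mono[OF scan le_refl this]]
    then show ?thesis
      unfolding decode_body_def decode_step_cost_def
      by (intro runs_Seq[OF runs_mono[OF pre le_refl]]) simp
  qed
  have start: "runs (decode_start N) s0 (com_weight (decode_start N) * M) (Inv 0)"
  proof (rule runs_loop_free)
    show "\<forall>x\<in>com_vars (decode_start N). val_size (s0 x) \<le> M"
      using M s0 n M2 by (auto simp: decode_start_def)
    show "Inv 0 (result (decode_start N) s0)"
      using s0 \<open>0 < N\<close> M n M2 by (auto simp: decode_start_def Inv_def floorlog_def)
  qed (use M2 in \<open>auto simp: decode_start_def\<close>)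
  have loop: "runs (While (Var (N + 1)) (decode_body N)) s
      ((n + 1) * (1 + M + decode_step_cost N n M)) (Inv (length es))"
    if "Inv 0 s" for s
  proof (rule runs_mono)
    show "runs (While (Var (N + 1)) (decode_body N)) s
        ((length ?vs + 1) * (1 + M + decode_step_cost N n M)) (Inv (length ?vs))"
      by (rule runs_While_list[OF _ step le_trans[OF n M2(2)] that]) (simp add: Inv_def)
    show "(length ?vs + 1) * (1 + M + decode_step_cost N n M) \<le>
        (n + 1) * (1 + M + decode_step_cost N n M)"
      using len by (intro mult_le_mono1) simp
  qed simp
  have fin: "runs (decode_end N) s (com_weight (decode_end N) * M) (\<lambda>s. \<exists>cs. distinct cs \<and>
    set cs = selected bs es ` {..<length es} \<and> s 0 = val_list (map vertex_val cs))"
    if "Inv (length es) s" for s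
    using that M2 M(1) by (intro runs_loop_free) (auto simp: decode_end_def Inv_def)
  show ?thesis
    unfolding decode_def decode_cost_def
    by (intro runs_Seq runs_mono[OF start] order.refl runs_mono[OF loop] fin) simp_all
qed

section \<open>Correctness of the reduction\<close>

lemma opt_le: "feasible P I S \<Longrightarrow> opt P I \<le> sol_size P S"
  unfolding opt_def by (rule Least_le) blast

lemma opt_attained:
  assumes "feasible P I S"
  shows "\<exists>S'. feasible P I S' \<and> sol_size P S' = opt P I"
  unfolding opt_def by (rule LeastI_ex) (use assms in blast)

text \<open>The encoding lists the endpoints of an edge in some order; that order decides which port
  of the edge is the first.\<close>

lemma codes_edges:
  "list_all2 codes_edge xs vs \<Longrightarrow>
    \<exists>es. xs = map (\<lambda>uw. {fst uw, snd uw}) es \<and> vs = map edge_val es"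
proof (induction rule: list_all2_induct)
  case (Cons x xs v vs)
  then obtain u w es where "x = {u, w}" "v = edge_val (u, w)"
    "xs = map (\<lambda>uw. {fst uw, snd uw}) es" "vs = map edge_val es"
    by (auto simp: codes_edge_def edge_val_def vertex_val_def)
  then show ?case by (intro exI[of _ "(u, w) # es"]) simp
qed simp

lemma codes_real_int: "codes_real (of_int a) (Cell (Num a) (Num 1))"
  unfolding codes_real_def by (intro exI[of _ a] exI[of _ 1]) simp

lemma codes_points:
  assumes "distinct zs"
  shows "codes_set codes_point (real_point ` set zs) (val_list (map point_val zs))"
proof -
  have "codes_point (real_point z) (point_val z)" for z
    by (cases z) (auto simp: codes_point_def point_val_def real_point_def codes_real_int)
  then have "list_all2 codes_point (map real_point zs) (map point_val zs)"
    by (simp add: list_all2_conv_all_nth)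
  moreover have "distinct (map real_point zs)"
    using assms inj_on_subset[OF inj_real_point subset_UNIV] by (simp add: distinct_map)
  ultimately show ?thesis
    unfolding codes_set_def by (intro exI[of _ "map real_point zs"] exI[of _ "map point_val zs"]) simp
qed

lemma codes_vertices:
  assumes "distinct cs"
  shows "codes_set codes_vertex (set cs) (val_list (map vertex_val cs))"
  unfolding codes_set_def using assms
  by (intro exI[of _ cs] exI[of _ "map vertex_val cs"])
    (simp add: list_all2_conv_all_nth codes_vertex_def vertex_val_def)

lemma (in edge_list) selected_eq:
  assumes "list_all2 codes_box Xs bs" "set Xs = T" "k < length es"
  shows "selected bs es k = endpoint k (served T k)"
proof -
  have "(\<exists>b\<in>set bs. box_serves b (5 * int k) (4 * int (fst (es ! k)))) \<longleftrightarrow> served T k"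
  proof -
    have "(\<exists>b\<in>set bs. box_serves b x y) \<longleftrightarrow>
        (\<exists>X\<in>set Xs. covers X (real_point (x + 1, y + 2)) \<and> covers X (real_point (x, y)))" for x y
      using assms(1) by (induction rule: list_all2_induct) (auto simp: box_serves_iff)
    then show ?thesis
      unfolding served_def assms(2)[symmetric] by (simp add: centre_def port_def endpoint_def)
  qed
  then show ?thesis by (simp add: selected_def endpoint_def)
qed

text \<open>The stars of the vertices of a cover exhaust the edges, and each star has at most
  \<open>d\<close> of them.\<close>

lemma card_edges_le:
  assumes "simple_graph (V, E)" "\<forall>v\<in>V. degree_in E v \<le> d" "vertex_cover (V, E) C"
  shows "card E \<le> d * card C"
proof -
  have C: "C \<subseteq> V" "finite C" "\<And>e. e \<in> E \<Longrightarrow> e \<inter> C \<noteq> {}"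
    using assms(1,3) finite_subset by (auto simp: vertex_cover_def simple_graph_def)
  have "finite E"
    using assms(1) finite_subset[of E "Pow V"] by (auto simp: simple_graph_def)
  have "card E \<le> card (\<Union>v\<in>C. {e \<in> E. v \<in> e})"
    using C \<open>finite E\<close> by (intro card_mono) auto
  also have "\<dots> \<le> (\<Sum>v\<in>C. degree_in E v)"
    unfolding degree_in_def by (rule card_UN_le[OF C(2)])
  also have "\<dots> \<le> (\<Sum>v\<in>C. d)" using assms(2) C(1) by (intro sum_mono) blast
  finally show ?thesis by (simp add: mult.commute)
qed

section \<open>Total cost and the approximation ratio\<close>

definition input_bound :: "nat \<Rightarrow> nat" where
  "input_bound n = 1 + size_bound n + size_bound n"

text \<open>By \<open>exec_val_size\<close> the output of the given program exceeds its input by no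
  more than its cost, whence the last argument of \<open>decode_cost\<close>.\<close>

definition total_cost :: "nat \<Rightarrow> nat poly \<Rightarrow> nat \<Rightarrow> nat" where
  "total_cost N p n = 1 + encode_cost N n +
    (1 + poly p (input_bound n) + decode_cost N n (input_bound n + poly p (input_bound n)))"

text \<open>The weights of the commands depend only on \<open>N\<close>, which is fixed with the
  given program, so they count as constants.\<close>

lemma is_poly_total_cost: "is_poly (total_cost N p)"
  unfolding total_cost_def[abs_def] encode_cost_def decode_cost_def decode_step_cost_def
    input_bound_def size_bound_def
  by (intro is_poly_intros)

lemma runs_reduction:
  fixes es :: "(nat \<times> nat) list" and v :: val
  defines "inp \<equiv> Cell (val_list (map point_val (points red_shapes es (length es))))
    (val_list (map point_val (points blue_shapes es (length es))))"
  assumes "0 < N" "com_vars c \<subseteq> {..<N}" and v: "v = Cell a (val_list (map edge_val es))"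
    and c: "exec c (init_state inp) t s" "t \<le> poly p (val_size inp)" "s 0 = val_list bs"
  shows "runs (Seq (encode N) (Seq c (decode N))) (init_state v) (total_cost N p (val_size v))
    (\<lambda>s. \<exists>cs. distinct cs \<and> set cs = selected bs es ` {..<length es} \<and>
      s 0 = val_list (map vertex_val cs))"
proof -
  define n where "n = val_size v"
  let ?M = "input_bound n + poly p (input_bound n)"
  have n: "val_size (val_list (map edge_val es)) \<le> n" by (simp add: n_def v)
  have "val_size (val_list (map point_val (points red_shapes es (length es)))) \<le> size_bound n"
    by (rule val_size_points[OF n le_refl shapes_bounds(1)]) (rule shapes_bounds(2))
  moreover have "val_size (val_list (map point_val (points blue_shapes es (length es)))) \<le> size_bound n"
    by (rule val_size_points[OF n le_refl shapes_bounds(3)]) (rule shapes_bounds(4))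
  ultimately have inp: "val_size inp \<le> input_bound n" by (simp add: inp_def input_bound_def)
  then have t: "t \<le> poly p (input_bound n)" using c(2) poly_nat_mono le_trans by blast
  have mid: "runs (Seq c (decode N)) s1 (1 + poly p (input_bound n) + decode_cost N n ?M)
    (\<lambda>s. \<exists>cs. distinct cs \<and> set cs = selected bs es ` {..<length es} \<and>
      s 0 = val_list (map vertex_val cs))"
    if s1: "s1 0 = inp" "s1 N = val_list (map edge_val es)" "s1 (N + 5) = Num 0"
      "\<forall>y. 0 < y \<and> y < N \<longrightarrow> s1 y = Num 0" "\<forall>y>N. val_size (s1 y) \<le> size_bound n" for s1
  proof -
    \<comment> \<open>The given program only sees variables below \<open>N\<close>, and there the
      state is its initial state.\<close>
    have "\<forall>x\<in>{..<N}. s1 x = init_state inp x" using s1 by (auto simp: init_state_def)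
    from exec_frame[OF c(1) \<open>com_vars c \<subseteq> {..<N}\<close> this] obtain r where
      r: "exec c s1 t r" "\<forall>x\<in>{..<N}. r x = s x" "\<forall>x. x \<notin> {..<N} \<longrightarrow> r x = s1 x" by blast
    have r0: "r 0 = val_list bs" using r(2) c(3) \<open>0 < N\<close> by simp
    have "val_size (val_list bs) \<le> ?M"
      using exec_val_size[OF r(1), of 0] s1(1) inp t r0 by simp
    moreover have "size_bound n \<le> ?M" by (simp add: input_bound_def)
    moreover have "val_size (r y) \<le> ?M" if "N < y" for y
    proof -
      have "val_size (r y) \<le> size_bound n" using r(3) s1(5) that by simp
      then show ?thesis by (simp add: input_bound_def)
    qed
    ultimately have "runs (decode N) r (decode_cost N n ?M)
      (\<lambda>s. \<exists>cs. distinct cs \<and> set cs = selected bs es ` {..<length es} \<and>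
        s 0 = val_list (map vertex_val cs))"
      using r0 r(3) s1(2,3) \<open>0 < N\<close> n by (intro runs_decode) simp_all
    with r(1) t have "runs c s1 (poly p (input_bound n)) (\<lambda>s'. runs (decode N) s' (decode_cost N n ?M)
      (\<lambda>s. \<exists>cs. distinct cs \<and> set cs = selected bs es ` {..<length es} \<and>
        s 0 = val_list (map vertex_val cs)))"
      unfolding runs_def[of c] by blast
    then show ?thesis by (rule runs_Seq)
  qed
  show ?thesis
    unfolding total_cost_def n_def[symmetric]
    by (rule runs_Seq, rule runs_mono[OF runs_encode[OF \<open>0 < N\<close> v, folded n_def inp_def] le_refl])
      (elim conjE, rule mid)
qed

theorem theorem9:
  fixes \<epsilon> :: real
  assumes "\<epsilon> > 0"
    and "poly_time_approximable BCC (1 + \<epsilon>)"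
  shows "\<forall>d :: nat. poly_time_approximable (Vertex_Cover d) (1 + (real d + 1) * \<epsilon>)"
proof
  fix d
  obtain c p where c: "\<And>I v. I \<in> instances BCC \<Longrightarrow> codes_instance BCC I v \<Longrightarrow>
      \<exists>t s S. exec c (init_state v) t s \<and> t \<le> poly p (val_size v) \<and>
        codes_solution BCC S (s 0) \<and> feasible BCC I S \<and>
        real (sol_size BCC S) \<le> (1 + \<epsilon>) * real (opt BCC I)"
    using assms(2) unfolding poly_time_approximable_def by blast
  \<comment> \<open>\<open>N\<close> lies above all variables of the given program; inserting 0
    makes the maximum exist and keeps variable 0 for input and output.\<close>
  obtain N where N: "0 < N" "com_vars c \<subseteq> {..<N}"
  proof
    show "com_vars c \<subseteq> {..<Suc (Max (insert 0 (com_vars c)))}"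
      using finite_com_vars[of c] by (auto simp: less_Suc_eq_le)
  qed simp
  obtain q where q: "\<And>n. total_cost N p n = poly q n"
    using is_poly_total_cost[of N p] unfolding is_poly_def by blast
  show "poly_time_approximable (Vertex_Cover d) (1 + (real d + 1) * \<epsilon>)"
    unfolding poly_time_approximable_def
  proof (intro exI[of _ "Seq (encode N) (Seq c (decode N))"] exI[of _ q] ballI allI impI)
    fix I v assume I: "I \<in> instances (Vertex_Cover d)" and v: "codes_instance (Vertex_Cover d) I v"
    obtain V E where VE: "I = (V, E)" by fastforce
    have graph: "simple_graph (V, E)" "\<forall>v\<in>V. degree_in E v \<le> d"
      using I by (auto simp: Vertex_Cover_def VE)
    obtain a b where ab: "codes_set codes_edge E b" "v = Cell a b"
      using v by (auto simp: Vertex_Cover_def VE codes_pair_def)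
    then obtain xs vs where xs: "distinct xs" "set xs = E" "list_all2 codes_edge xs vs" "b = val_list vs"
      unfolding codes_set_def by blast
    then obtain es where es: "xs = map (\<lambda>uw. {fst uw, snd uw}) es" "vs = map edge_val es"
      using codes_edges by blast
    have E: "{fst (es ! e), snd (es ! e)} \<in> E" if "e < length es" for e
      using xs(2) es(1) that by auto
    have m: "card E = length es" using xs(1,2) es(1) by (metis distinct_card length_map)
    interpret edge_list es
    proof
      fix e assume "e < length es"
      from E[OF this] have "card {fst (es ! e), snd (es ! e)} = 2"
        using graph(1) by (auto simp: simple_graph_def)
      then show "fst (es ! e) \<noteq> snd (es ! e)" by auto
    qed
    let ?inp = "Cell (val_list (map point_val (points red_shapes es (length es))))
      (val_list (map point_val (points blue_shapes es (length es))))"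
    have "codes_instance BCC (point_sets es) ?inp"
      using codes_points[OF distinct_red_points] codes_points[OF distinct_blue_points]
      by (auto simp: BCC_def codes_pair_def point_sets_def)
    from c[OF point_sets_instance this] obtain t s T where
      run: "exec c (init_state ?inp) t s" "t \<le> poly p (val_size ?inp)"
      and T: "codes_set codes_box T (s 0)" "class_cover (point_sets es) T"
        "real (card T) \<le> (1 + \<epsilon>) * real (opt BCC (point_sets es))"
      by (auto simp: BCC_def)
    from T(1) obtain Xs bs where Xs: "set Xs = T" "list_all2 codes_box Xs bs" "s 0 = val_list bs"
      unfolding codes_set_def by blast
    have "selected bs es ` {..<length es} = chosen T"
      unfolding chosen_def using selected_eq[OF Xs(2,1)] by (intro image_cong) auto
    with runs_reduction[OF N _ run Xs(3), of v a] obtain t' s' cs where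
      run': "exec (Seq (encode N) (Seq c (decode N))) (init_state v) t' s'"
        "t' \<le> poly q (val_size v)"
      and cs: "distinct cs" "set cs = chosen T" "s' 0 = val_list (map vertex_val cs)"
      unfolding runs_def q using ab(2) xs(4) es(2) by auto
    have cover: "vertex_cover (V, E) (chosen T)"
    proof -
      have "chosen T \<subseteq> V"
        using E graph(1) by (fastforce simp: chosen_def endpoint_def simple_graph_def)
      moreover have "e \<inter> chosen T \<noteq> {}" if "e \<in> E" for e
      proof -
        from that obtain k where "k < length es" "e = {fst (es ! k), snd (es ! k)}"
          using xs(2) es(1) by (auto simp: in_set_conv_nth)
        then have "endpoint k (served T k) \<in> e \<inter> chosen T"
          by (auto simp: endpoint_def chosen_def)
        then show ?thesis by blast
      qed
      ultimately show ?thesis by (simp add: vertex_cover_def)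
    qed
    \<comment> \<open>\<open>opt\<close> is a \<open>LEAST\<close> term, attained only if some
      feasible solution exists; \<open>chosen T\<close> is one.\<close>
    then obtain C where C: "vertex_cover (V, E) C" "card C = opt (Vertex_Cover d) I"
      using opt_attained[of "Vertex_Cover d" I "chosen T"] by (auto simp: Vertex_Cover_def VE)
    have "finite C" using C(1) graph(1) finite_subset by (auto simp: vertex_cover_def simple_graph_def)
    moreover have "\<exists>q. endpoint e q \<in> C" if "e < length es" for e
    proof -
      have "{fst (es ! e), snd (es ! e)} \<inter> C \<noteq> {}" using C(1) E[OF that] by (auto simp: vertex_cover_def)
      then have "endpoint e False \<in> C \<or> endpoint e True \<in> C" by (auto simp: endpoint_def)
      then show ?thesis by blast
    qed
    ultimately obtain T' where "class_cover (point_sets es) T'" "card T' \<le> card C + length es"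
      using class_cover_exists by blast
    then have "opt BCC (point_sets es) \<le> card C + length es"
      using opt_le[of BCC "point_sets es" T'] by (simp add: BCC_def)
    then have opt: "real (opt BCC (point_sets es)) \<le> real (card C) + real (length es)" by linarith
    have "length es \<le> d * card C" using card_edges_le[OF graph C(1)] m by simp
    then have deg: "real (length es) \<le> real d * real (card C)" by (metis of_nat_le_iff of_nat_mult)
    have "real (card (chosen T)) + real (length es) \<le> real (card T)"
      using card_chosen[OF T(2)] by linarith
    also have "\<dots> \<le> (1 + \<epsilon>) * (real (card C) + real (length es))"
      using T(3) mult_left_mono[OF opt, of "1 + \<epsilon>"] assms(1) by linarith
    \<comment> \<open>The number of edges cancels except in the term with factor \<epsilon>, so the
      degree bound enlarges only the error and not the leading 1.\<close>
    finally have "real (card (chosen T)) \<le> real (card C) + \<epsilon> * (real (card C) + real (length es))"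
      by (simp add: algebra_simps)
    also have "\<dots> \<le> real (card C) + \<epsilon> * (real (card C) + real d * real (card C))"
      using mult_left_mono[OF deg, of \<epsilon>] assms(1) by (simp add: algebra_simps)
    also have "\<dots> = (1 + (real d + 1) * \<epsilon>) * real (card C)" by (simp add: algebra_simps)
    finally have "real (card (chosen T)) \<le> (1 + (real d + 1) * \<epsilon>) * real (card C)" .
    moreover have "codes_set codes_vertex (chosen T) (s' 0)"
      using codes_vertices[OF cs(1)] cs(2,3) by simp
    ultimately show "\<exists>t s S. exec (Seq (encode N) (Seq c (decode N))) (init_state v) t s \<and>
      t \<le> poly q (val_size v) \<and> codes_solution (Vertex_Cover d) S (s 0) \<and>
      feasible (Vertex_Cover d) I S \<and>
      real (sol_size (Vertex_Cover d) S) \<le> (1 + (real d + 1) * \<epsilon>) * real (opt (Vertex_Cover d) I)"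
      using run' cover C(2) by (intro exI[of _ t'] exI[of _ s'] exI[of _ "chosen T"]) (simp add: Vertex_Cover_def VE)
  qed
qed

end
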